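(* Let $K\subset\mathbb{R}^n$ be a closed convex set, $\mu_0\in K$, $h\sim\mathcal{N}(0,I_n)$, and $\mathrm{err}(\sigma)=\|\Pi_K(\mu_0+\sigma h)-\mu_0\|^2$ for $\sigma>0$. The following hold. (1) For all $\sigma>0$, $\lim_{\tau\uparrow\infty}\|\Pi_K(\tau h)\|^2/\tau^2\le\mathrm{err}(\sigma)/\sigma^2\le\|h\|^2$. The lower bound is achieved as $\sigma\uparrow\infty$, i.e. $\lim_{\sigma\uparrow\infty}\mathrm{err}(\sigma)/\sigma^2=\lim_{\tau\uparrow\infty}\|\Pi_K(\tau h)\|^2/\tau^2$, and also in expectation: $\lim_{\sigma\uparrow\infty}\mathbb{E}\,\mathrm{err}(\sigma)/\sigma^2=\delta_K$. Furthermore, $\lim_{\sigma\downarrow0}\mathbb{E}\,\mathrm{err}(\sigma)/\sigma^2=\delta_{T_K(\mu_0)}$. Consequently $\delta_K\le\delta_{T_K(\mu_0)}$ for any $\mu_0\in K$. (2) $\mathrm{Var}(\mathrm{err}(\sigma))\le4\sigma^2\,\mathbb{E}\,\mathrm{err}(\sigma)$. (3) For any $\lambda<1/(2\sigma^2)$, $$\mathbb{E}\exp\big(\lambda(\mathrm{err}(\sigma)-\mathbb{E}\,\mathrm{err}(\sigma))\big)\le\exp\bigg(\frac{2\sigma^2\lambda^2\,\mathbb{E}\,\mathrm{err}(\sigma)}{1-2\sigma^2\lambda}\bigg).$$ Consequently, for all $t\ge0$, $$\mathbb{P}\Big(|\mathrm{err}(\sigma)-\mathbb{E}\,\mathrm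{err}(\sigma)|\ge\sqrt{8\sigma^2\,\mathbb{E}\,\mathrm{err}(\sigma)\,t}+2\sigma^2t\Big)\le2e^{-t}.$$
   Context: $\Pi_K$ is the metric projection onto $K$; $\|\cdot\|$ is the Euclidean norm. $\delta_K=\lim_{\tau\uparrow\infty}\mathbb{E}\|\Pi_K(\tau h)\|^2/\tau^2$, which equals $\mathbb{E}\|\Pi_K(h)\|^2$ when $K$ is a closed convex cone. $T_K(\mu_0)=\mathrm{cl}\{\alpha(\nu-\mu_0):\alpha\ge0,\nu\in K\}$ is the tangent cone. *)

theory Defs
  imports "HOL-Probability.Probability"
begin

definition std_gaussian_vector :: "'w measure \<Rightarrow> ('w \<Rightarrow> real ^ 'n) \<Rightarrow> bool" where
  "std_gaussian_vector M h \<longleftrightarrow>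
     distributed M lborel h (\<lambda>x. ennreal (\<Prod>i\<in>UNIV. std_normal_density (x $ i)))"

text \<open>The squared error at the noise realization \<open>x\<close>; \<^const>\<open>closest_point\<close> is the metric
  projection, which is uniquely determined on nonempty closed convex sets.\<close>

definition err :: "(real ^ 'n) set \<Rightarrow> real ^ 'n \<Rightarrow> real \<Rightarrow> real ^ 'n \<Rightarrow> real" where
  "err K \<mu>0 \<sigma> x = (norm (closest_point K (\<mu>0 + \<sigma> *\<^sub>R x) - \<mu>0))\<^sup>2"

definition tangent_cone :: "(real ^ 'n) set \<Rightarrow> real ^ 'n \<Rightarrow> (real ^ 'n) set" where
  "tangent_cone K \<mu>0 = closure {\<alpha> *\<^sub>R (\<nu> - \<mu>0) | \<alpha> \<nu>. \<alpha> \<ge> 0 \<and> \<nu> \<in> K}"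

text \<open>The statistical dimension. As \<^const>\<open>Lim\<close> is unspecified when there is no limit, every use
  has to be accompanied by the claim that the limit exists.\<close>

definition stat_dim :: "'w measure \<Rightarrow> ('w \<Rightarrow> real ^ 'n) \<Rightarrow> (real ^ 'n) set \<Rightarrow> real" where
  "stat_dim M h K =
     Lim at_top (\<lambda>\<tau>::real. (\<integral>\<omega>. (norm (closest_point K (\<tau> *\<^sub>R h \<omega>)))\<^sup>2 \<partial>M) / \<tau>\<^sup>2)"

end

theory Submission
  imports Defs
begin

text \<open>If \<open>E x \<le> exp (\<phi> y + \<parallel>x - y\<parallel>\<^sup>2 / 2)\<close> for all \<open>x, y\<close>, then the Gaussian mean of \<open>E\<close> is at most
  \<open>exp\<close> of that of \<open>\<phi>\<close>: this dual form of Talagrand's transport inequality follows from monotone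
  rearrangement in one dimension and tensorizes. For a 1-Lipschitz \<open>g\<close> and
  \<open>\<phi> = l g\<^sup>2 / (1 - 2 l)\<close> it reads
  \<open>\<bbbE> exp (l g\<^sup>2) \<le> exp (l \<bbbE> g\<^sup>2 / (1 - 2 l))\<close>, for all \<open>l < 1/2\<close> of either sign. The error
  is \<open>\<sigma>\<^sup>2 g\<^sup>2\<close> with \<open>g x = \<parallel>\<Pi>\<^sub>K (\<mu>0 + \<sigma> x) - \<mu>0\<parallel> / \<sigma>\<close>, so this is the exponential moment
  bound, whose expansion at \<open>l = 0\<close> gives the variance bound and whose Chernoff bound gives the
  tail. The limits in \<open>\<sigma>\<close> come from the monotonicity of \<open>\<parallel>\<Pi>\<^sub>K (\<mu>0 + \<sigma> x) - \<mu>0\<parallel> / \<sigma>\<close>, the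
  description of the latter as a projection onto \<open>(K - \<mu>0) / \<sigma>\<close>, and dominated convergence.\<close>

section \<open>Gaussian transport on the line\<close>

text \<open>A gradient estimate for the error followed by a logarithmic Sobolev inequality would
  require differentiating the projection. The transport route uses only that the projection is
  nonexpansive.

  The hypothesis is kept as a family of inequalities between pairs \<open>x, y\<close> instead of an
  infimal convolution. In this form it survives integration over one coordinate, and
  \<open>E\<close> can be any measurable function with values in \<open>ennreal\<close>, so the
  finiteness of its Gaussian mean is a conclusion.

  The price is a growth condition: \<open>\<phi>\<close> may decrease at most like
  \<open>- b * y^2\<close> with \<open>b < 1 / 2\<close>, so that half the square distance dominates
  it. A negative \<open>l\<close> meets this condition, because \<open>l / (1 - 2 * l)\<close> then
  lies strictly between \<open>- 1 / 2\<close> and 0.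

  On the line the argument starts on a bounded interval, where both weights are continuous and
  positive and the rearrangement fixes the end points.\<close>

lemma integral_upto_pos_density:
  fixes q :: "real \<Rightarrow> real"
  assumes ab: "a < b" and q: "continuous_on {a..b} q" and pos: "\<forall>x\<in>{a..b}. 0 < q x"
    and G: "G = (\<lambda>x. integral {a..x} q)"
  shows "\<And>x. x \<in> {a..b} \<Longrightarrow> (G has_real_derivative q x) (at x within {a..b})"
    and "\<And>x. x \<in> {a<..<b} \<Longrightarrow> (G has_real_derivative q x) (at x)"
    and "continuous_on {a..b} G"
    and "strict_mono_on {a..b} G"
    and "G ` {a..b} = {0..G b}"
    and "0 < G b"
proof -
  show d: "(G has_real_derivative q x) (at x within {a..b})" if "x \<in> {a..b}" for x
    unfolding G using integral_has_real_derivative[OF q that] .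
  show d': "(G has_real_derivative q x) (at x)" if "x \<in> {a<..<b}" for x
  proof -
    have "at x within {a..b} = at x"
      using that by (intro at_within_interior) simp
    with d[of x] that show ?thesis by simp
  qed
  show c: "continuous_on {a..b} G"
    using d by (intro continuous_on_vector_derivative)
      (auto simp: has_real_derivative_iff_has_vector_derivative)
  show m: "strict_mono_on {a..b} G"
  proof (rule strict_mono_onI)
    fix x y assume xy: "x \<in> {a..b}" "y \<in> {a..b}" "x < y"
    show "G x < G y"
    proof (rule DERIV_pos_imp_increasing_open[OF xy(3)])
      show "continuous_on {x..y} G"
        using xy by (intro continuous_on_subset[OF c]) auto
      fix z assume z: "x < z" "z < y"
      then show "\<exists>w. (G has_real_derivative w) (at z) \<and> 0 < w"
        using xy d'[of z] pos by force
    qed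
  qed
  have Ga: "G a = 0" by (simp add: G)
  show "0 < G b" using strict_mono_onD[OF m, of a b] ab Ga by simp
  have sub: "G ` {a..b} \<subseteq> {0..G b}"
    using strict_mono_on_leD[OF m] Ga by (fastforce simp: image_subset_iff)
  have "{0..G b} \<subseteq> G ` {a..b}"
  proof
    fix y assume "y \<in> {0..G b}"
    then obtain x where "a \<le> x" "x \<le> b" "G x = y"
      using IVT'[of G a y b] Ga c ab by auto
    then show "y \<in> G ` {a..b}" by auto
  qed
  with sub show "G ` {a..b} = {0..G b}" by blast
qed

text \<open>The map is the inverse of one cumulative integral applied to a multiple of the other.
  The multiple equalizes the two masses, which forces \<open>T\<close> to fix both end points. A
  derivative in the open interval is all that the fundamental theorem of calculus will ask
  for.\<close>

lemma monotone_rearrangement: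
  fixes p q :: "real \<Rightarrow> real"
  assumes ab: "a < b"
    and p: "continuous_on {a..b} p" "\<forall>x\<in>{a..b}. 0 < p x"
    and q: "continuous_on {a..b} q" "\<forall>x\<in>{a..b}. 0 < q x"
  obtains T where "continuous_on {a..b} T" "T a = a" "T b = b"
    "\<And>x. x \<in> {a<..<b} \<Longrightarrow>
      (T has_real_derivative (integral {a..b} q / integral {a..b} p) * p x / q (T x)) (at x)"
proof -
  define F where "F = (\<lambda>x. integral {a..x} p)"
  define G where "G = (\<lambda>x. integral {a..x} q)"
  note F = integral_upto_pos_density[OF ab p(1,2) F_def]
  note G = integral_upto_pos_density[OF ab q G_def]
  define H where "H = the_inv_into {a..b} G"
  have inj: "inj_on G {a..b}" using G(4) by (rule strict_mono_on_imp_inj_on)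
  have HG: "H (G x) = x" if "x \<in> {a..b}" for x
    unfolding H_def using the_inv_into_f_f[OF inj that] .
  have GH: "G (H y) = y" if "y \<in> {0..G b}" for y
    unfolding H_def using f_the_inv_into_f[OF inj, of y] G(5) that by auto
  have H_in: "H y \<in> {a..b}" if "y \<in> {0..G b}" for y
    using the_inv_into_into[OF inj _ order_refl, of y] G(5) that by (auto simp: H_def)
  have Hc: "continuous_on {0..G b} H"
    using continuous_on_inv[OF G(3) compact_Icc, of H] HG G(5) by simp
  define r where "r = G b / F b"
  have r: "r > 0" using F(6) G(6) by (simp add: r_def)
  define T where "T = (\<lambda>x. H (r * F x))"
  have Ga: "G a = 0" and Fa: "F a = 0" by (simp_all add: G_def F_def)
  have rF: "r * F x \<in> {0..G b}" if "x \<in> {a..b}" for x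
  proof -
    have "F x \<in> {0..F b}" using F(5) that by blast
    then have "0 \<le> r * F x" "r * F x \<le> r * F b" using r by auto
    then show ?thesis using F(6) by (simp add: r_def)
  qed
  show ?thesis
  proof (rule that[of T])
    show "continuous_on {a..b} T"
      unfolding T_def
      by (rule continuous_on_compose2[OF Hc])
         (use rF in \<open>auto intro!: continuous_intros F(3)\<close>)
    show "T a = a" using HG[of a] ab Fa Ga by (simp add: T_def)
    show "T b = b" using HG[of b] ab F(6) by (simp add: T_def r_def)
    fix x assume x: "x \<in> {a<..<b}"
    have strict: "0 < r * F x" "r * F x < G b"
    proof -
      have "F a < F x" "F x < F b"
        using strict_mono_onD[OF F(4)] x by auto
      then have "0 < r * F x" "r * F x < r * F b" using r Fa by auto
      then show "0 < r * F x" "r * F x < G b" using F(6) by (simp_all add: r_def)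
    qed
    \<comment> \<open>The value has to be interior because \<open>G\<close> has a two-sided
      derivative only there.\<close>
    have Tx: "T x \<in> {a<..<b}"
    proof -
      have "T x \<in> {a..b}" using H_in[OF rF] x by (simp add: T_def)
      moreover have "G (T x) = r * F x" using GH[OF rF] x by (simp add: T_def)
      ultimately show ?thesis using strict Ga by (cases "T x = a"; cases "T x = b") auto
    qed
    have "(H has_real_derivative inverse (q (T x))) (at (r * F x))"
    proof (rule DERIV_inverse_function[of G])
      show "(G has_real_derivative q (T x)) (at (H (r * F x)))"
        using G(2)[OF Tx] by (simp add: T_def)
      show "q (T x) \<noteq> 0" using q(2) Tx by (auto dest!: bspec[of _ _ "T x"])
      show "isCont H (r * F x)"
        using Hc strict by (simp add: continuous_on_interior)
      show "\<And>y. 0 < y \<Longrightarrow> y < G b \<Longrightarrow> G (H y) = y" using GH by simp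
    qed (use strict in auto)
    then have "(T has_real_derivative inverse (q (T x)) * (r * p x)) (at x)"
      unfolding T_def
      by (rule DERIV_chain2) (intro DERIV_cmult F(2)[OF x])
    then show "(T has_real_derivative integral {a..b} q / integral {a..b} p * p x / q (T x)) (at x)"
      by (simp add: r_def F_def G_def field_simps)
  qed
qed

text \<open>With \<open>T\<close> the increasing map carrying the Gaussian weight \<open>p\<close> to \<open>exp k\<close>, the hypothesis
  at the pair \<open>(T x, x)\<close> and \<open>ln T' \<le> T' - 1\<close> bound the constant \<open>ln (Z / c)\<close> by
  \<open>\<phi> + ((T - id) p)' / p\<close>; the boundary terms of the exact derivative vanish.\<close>

lemma gaussian_transport_Icc:
  fixes k \<phi> :: "real \<Rightarrow> real"
  assumes N: "N > 0" and k: "continuous_on UNIV k"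
    and \<phi>: "(\<lambda>x. \<phi> x * std_normal_density x) integrable_on {-N..N}"
    and le: "\<And>x y. k x + x * y \<le> \<phi> y + y\<^sup>2 / 2"
  defines "c \<equiv> integral {-N..N} std_normal_density"
  shows "integral {-N..N} (\<lambda>x. exp (k x) / sqrt (2 * pi))
     \<le> c * exp (integral {-N..N} (\<lambda>x. \<phi> x * std_normal_density x) / c)"
proof -
  define p :: "real \<Rightarrow> real" where "p = std_normal_density"
  define q where "q = (\<lambda>x. exp (k x) / sqrt (2 * pi))"
  define Z where "Z = integral {-N..N} q"
  have p_eq: "p x = exp (- x\<^sup>2 / 2) / sqrt (2 * pi)" for x
    by (simp add: p_def std_normal_density_def)
  have pc: "continuous_on S p" for S
    unfolding p_eq[abs_def] by (intro continuous_intros) auto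
  have qc: "continuous_on S q" for S
    unfolding q_def by (intro continuous_intros continuous_on_subset[OF k]) auto
  have ppos: "\<forall>x\<in>S. 0 < p x" and qpos: "\<forall>x\<in>S. 0 < q x" for S by (simp_all add: p_eq q_def)
  have ab: "-N < N" using N by simp
  have cdef: "c = integral {-N..N} p" by (simp add: c_def p_def)
  have cpos: "c > 0" and Zpos: "Z > 0"
    using integral_upto_pos_density(6)[OF ab pc ppos refl] integral_upto_pos_density(6)[OF ab qc qpos refl]
    by (simp_all add: cdef Z_def)
  obtain T where T: "continuous_on {-N..N} T" "T (-N) = -N" "T N = N"
    and dT: "\<And>x. x \<in> {-N<..<N} \<Longrightarrow> (T has_real_derivative (Z / c) * p x / q (T x)) (at x)"
    using monotone_rearrangement[OF ab pc ppos qc qpos] unfolding Z_def cdef by metis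
  \<comment> \<open>This is the derivative of \<open>(T x - x) * p x\<close>, expanded with
    \<open>p' = - x p\<close>.\<close>
  define D where "D = (\<lambda>x. ((Z / c) * p x / q (T x) - 1) * p x - (T x - x) * x * p x)"
  have dp: "(p has_real_derivative - x * p x) (at x)" for x
    unfolding p_eq[abs_def] by (auto intro!: derivative_eq_intros simp: field_simps)
  have "(D has_integral ((T N - N) * p N - (T (-N) - (-N)) * p (-N))) {-N..N}"
  proof (rule fundamental_theorem_of_calculus_interior)
    show "- N \<le> N" using N by simp
    show "continuous_on {- N..N} (\<lambda>x. (T x - x) * p x)"
      by (intro continuous_intros T pc)
    fix x assume "x \<in> {-N<..<N}"
    from dT[OF this] show "((\<lambda>x. (T x - x) * p x) has_vector_derivative D x) (at x)"
      unfolding has_real_derivative_iff_has_vector_derivative[symmetric] D_def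
      by (auto intro!: derivative_eq_intros dp simp: algebra_simps)
  qed
  then have D: "(D has_integral 0) {-N..N}" using T by simp
  have pt: "ln (Z / c) * p x \<le> D x + \<phi> x * p x" if "x \<in> {-N..N}" for x
  proof -
    define t where "t = (Z / c) * p x / q (T x)"
    have t: "t > 0" unfolding t_def using Zpos cpos ppos[of UNIV] qpos[of UNIV] by simp
    have "t = (Z / c) * exp (- x\<^sup>2 / 2 - k (T x))"
      unfolding t_def p_eq q_def by (simp add: exp_diff)
    then have "ln t = ln (Z / c) + (- x\<^sup>2 / 2 - k (T x))"
      using Zpos cpos by (simp add: ln_mult_pos del: times_divide_eq_left)
    moreover have "ln t \<le> t - 1" using t by (rule ln_le_minus_one)
    moreover have "k (T x) \<le> \<phi> x + x\<^sup>2 / 2 - T x * x" using le[of "T x" x] by simp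
    \<comment> \<open>One half of \<open>x^2\<close> comes from the Gaussian exponent, the other
      from the quadratic cost. With \<open>- T x * x\<close> they make up the second term of
      \<open>D x / p x\<close>.\<close>
    ultimately have "ln (Z / c) \<le> t - 1 - (T x - x) * x + \<phi> x"
      by (simp add: algebra_simps power2_eq_square)
    then have "ln (Z / c) * p x \<le> (t - 1 - (T x - x) * x + \<phi> x) * p x"
      using ppos[of UNIV] by (intro mult_right_mono) (auto intro: less_imp_le)
    also have "\<dots> = D x + \<phi> x * p x" unfolding D_def t_def by (simp add: algebra_simps)
    finally show ?thesis .
  qed
  have "((\<lambda>x. ln (Z / c) * p x) has_integral (ln (Z / c) * c)) {-N..N}"
    unfolding cdef by (intro has_integral_mult_right integrable_integral integrable_continuous_real pc)
  moreover have "((\<lambda>x. D x + \<phi> x * p x) has_integral (0 + integral {-N..N} (\<lambda>x. \<phi> x * p x))) {-N..N}"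
    by (intro has_integral_add D integrable_integral) (use \<phi> p_def in simp)
  ultimately have "ln (Z / c) * c \<le> 0 + integral {-N..N} (\<lambda>x. \<phi> x * p x)"
    by (rule has_integral_le) (rule pt)
  then have "ln (Z / c) \<le> integral {-N..N} (\<lambda>x. \<phi> x * p x) / c"
    using cpos by (simp add: field_simps)
  then have "Z / c \<le> exp (integral {-N..N} (\<lambda>x. \<phi> x * p x) / c)"
    using Zpos cpos by (metis divide_pos_pos exp_le_cancel_iff exp_ln)
  then show ?thesis
    using cpos by (simp add: Z_def q_def p_def field_simps)
qed

abbreviation std_gaussian :: "real measure" where
  "std_gaussian \<equiv> density lborel (\<lambda>x. ennreal (std_normal_density x))"

text \<open>Carries the truncated inequality to the whole line. \<open>Suc n\<close> keeps the
  intervals nondegenerate, as \<open>gaussian_transport_Icc\<close> asks for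
  \<open>N > 0\<close>.\<close>

lemma integral_Icc_tendsto:
  fixes f :: "real \<Rightarrow> real"
  assumes f: "integrable lborel f"
  shows "(\<lambda>n. integral {- real (Suc n)..real (Suc n)} f) \<longlonglongrightarrow> integral\<^sup>L lborel f"
    and "f integrable_on {a..b}"
proof -
  have s: "set_integrable lborel {a..b} f" for a b
    using f unfolding set_integrable_def by (intro integrable_mult_indicator) auto
  show "f integrable_on {a..b}" using set_borel_integral_eq_integral(1)[OF s] .
  have "(\<lambda>n. LINT x|lborel. indicator {- real (Suc n)..real (Suc n)} x *\<^sub>R f x)
     \<longlonglongrightarrow> integral\<^sup>L lborel f"
  proof (rule integral_dominated_convergence)
    show "integrable lborel (\<lambda>x. \<bar>f x\<bar>)" using f by simp
    show "AE x in lborel. (\<lambda>n. indicator {- real (Suc n)..real (Suc n)} x *\<^sub>R f x) \<longlonglongrightarrow> f x"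
    proof (rule AE_I2, rule tendsto_eventually)
      fix x :: real
      have "\<forall>\<^sub>F n in sequentially. \<bar>x\<bar> \<le> real n"
        using filterlim_real_sequentially by (simp add: filterlim_at_top)
      then show "\<forall>\<^sub>F n in sequentially. indicator {- real (Suc n)..real (Suc n)} x *\<^sub>R f x = f x"
        by eventually_elim (auto simp: indicator_def)
    qed
  qed (use f in \<open>auto split: split_indicator\<close>)
  then show "(\<lambda>n. integral {- real (Suc n)..real (Suc n)} f) \<longlonglongrightarrow> integral\<^sup>L lborel f"
    using set_borel_integral_eq_integral(2)[OF s] by (simp add: set_lebesgue_integral_def)
qed

text \<open>Here \<open>E x\<close> is \<open>exp (k x + x^2 / 2)\<close>. Expanding
  \<open>(x - y)^2 / 2\<close> cancels \<open>x^2 / 2\<close> from the pair condition, and the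
  Gaussian weight times \<open>E x\<close> is \<open>exp (k x) / sqrt (2 * pi)\<close>.\<close>

lemma gaussian_transport_continuous:
  fixes k \<phi> :: "real \<Rightarrow> real"
  assumes k: "continuous_on UNIV k" and \<phi>: "integrable std_gaussian \<phi>"
    and le: "\<And>x y. k x + x * y \<le> \<phi> y + y\<^sup>2 / 2"
  shows "(\<integral>\<^sup>+x. ennreal (exp (k x) / sqrt (2 * pi)) \<partial>lborel) \<le> ennreal (exp (\<integral>x. \<phi> x \<partial>std_gaussian))"
proof -
  define q where "q = (\<lambda>x. exp (k x) / sqrt (2 * pi))"
  define f where "f = (\<lambda>x. \<phi> x * std_normal_density x)"
  define S where "S = (\<lambda>n. {- real (Suc n)..real (Suc n)})"
  define c where "c = (\<lambda>n. integral (S n) std_normal_density)"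
  define J where "J = (\<lambda>n. integral (S n) f)"
  have qc: "continuous_on X q" for X
    unfolding q_def by (intro continuous_intros continuous_on_subset[OF k]) auto
  have \<phi>m[measurable]: "\<phi> \<in> borel_measurable borel"
    using borel_measurable_integrable[OF \<phi>] by simp
  have f: "integrable lborel f"
    using \<phi> by (simp add: integrable_density f_def mult.commute)
  have I: "(\<integral>x. \<phi> x \<partial>std_gaussian) = integral\<^sup>L lborel f"
    by (simp add: integral_density f_def mult.commute)
  have Jt: "J \<longlonglongrightarrow> integral\<^sup>L lborel f"
    unfolding J_def S_def by (rule integral_Icc_tendsto[OF f])
  have ct: "c \<longlonglongrightarrow> 1"
    using integral_Icc_tendsto(1)[OF integrable_normal_density[of 1 0]]
    unfolding c_def S_def by simp
  have bound: "integral (S n) q \<le> c n * exp (J n / c n)" for n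
    unfolding c_def J_def S_def q_def f_def
    using integral_Icc_tendsto(2)[OF f] k le
    by (intro gaussian_transport_Icc) (auto simp: f_def)
  have "(\<lambda>n. c n * exp (J n / c n)) \<longlonglongrightarrow> 1 * exp (integral\<^sup>L lborel f / 1)"
    by (intro tendsto_intros Jt ct) simp
  then have R: "(\<lambda>n. ennreal (c n * exp (J n / c n))) \<longlonglongrightarrow> ennreal (exp (integral\<^sup>L lborel f))"
    by (intro tendsto_ennrealI) simp
  \<comment> \<open>Monotone convergence, because the limit is not yet known to be finite.\<close>
  have L: "(\<lambda>n. \<integral>\<^sup>+x. ennreal (q x) * indicator (S n) x \<partial>lborel) \<longlonglongrightarrow> (\<integral>\<^sup>+x. ennreal (q x) \<partial>lborel)"
  proof (rule nn_integral_LIMSEQ)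
    show "incseq (\<lambda>n x. ennreal (q x) * indicator (S n) x)"
      by (auto simp: incseq_def le_fun_def S_def split: split_indicator)
    show "(\<lambda>x. ennreal (q x) * indicator (S n) x) \<in> borel_measurable lborel" for n
      using borel_measurable_continuous_onI[OF qc] by (simp add: S_def)
    fix x :: real
    have "\<forall>\<^sub>F n in sequentially. \<bar>x\<bar> \<le> real n"
      using filterlim_real_sequentially by (simp add: filterlim_at_top)
    then have "\<forall>\<^sub>F n in sequentially. ennreal (q x) * indicator (S n) x = ennreal (q x)"
      by eventually_elim (auto simp: indicator_def S_def)
    then show "(\<lambda>n. ennreal (q x) * indicator (S n) x) \<longlonglongrightarrow> ennreal (q x)"
      by (rule tendsto_eventually)
  qed
  have "(\<integral>\<^sup>+x. ennreal (q x) * indicator (S n) x \<partial>lborel) = ennreal (integral (S n) q)" for n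
    unfolding S_def
    by (intro nn_integral_has_integral_lebesgue' integrable_integral integrable_continuous_real qc)
       (simp add: q_def)
  with L have "(\<lambda>n. ennreal (integral (S n) q)) \<longlonglongrightarrow> (\<integral>\<^sup>+x. ennreal (q x) \<partial>lborel)"
    by simp
  from LIMSEQ_le[OF this R] show ?thesis
    using bound by (auto simp: I q_def intro!: ennreal_leI)
qed

lemma std_gaussian_facts:
  shows prob_space_std_gaussian: "prob_space std_gaussian"
    and integrable_std_gaussian_square: "integrable std_gaussian (\<lambda>x. x\<^sup>2)"
    and integral_std_gaussian_square: "(\<integral>x. x\<^sup>2 \<partial>std_gaussian) = 1"
proof -
  show "prob_space std_gaussian" by (rule prob_space_normal_density) simp
  have "has_bochner_integral lborel (\<lambda>x. std_normal_density x * x\<^sup>2) 1"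
    using std_normal_moment_even[of 1] by (simp add: fact_numeral)
  then show "integrable std_gaussian (\<lambda>x. x\<^sup>2)" "(\<integral>x. x\<^sup>2 \<partial>std_gaussian) = 1"
    by (auto simp: integrable_density integral_density has_bochner_integral_iff)
qed

text \<open>Since the second moment is 1, integrating out a coordinate turns its quadratic term into
  a constant. The tensorization needs this to keep its growth bounds.\<close>

lemma integrable_quadratic_bound:
  fixes \<phi> :: "real \<Rightarrow> real"
  assumes [measurable]: "\<phi> \<in> borel_measurable borel"
    and \<phi>: "\<And>y. - a - b * y\<^sup>2 \<le> \<phi> y" "\<And>y. \<phi> y \<le> A + B * y\<^sup>2"
  shows "integrable std_gaussian \<phi>"
    and "- a - b \<le> (\<integral>x. \<phi> x \<partial>std_gaussian)" "(\<integral>x. \<phi> x \<partial>std_gaussian) \<le> A + B"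
proof -
  interpret prob_space std_gaussian by (rule prob_space_std_gaussian)
  note [simp] = integrable_std_gaussian_square integral_std_gaussian_square
  have i: "integrable std_gaussian (\<lambda>x. \<bar>A\<bar> + \<bar>a\<bar> + (\<bar>B\<bar> + \<bar>b\<bar>) * x\<^sup>2)"
    by (intro Bochner_Integration.integrable_add integrable_mult_right) simp_all
  have bd: "\<bar>\<phi> y\<bar> \<le> \<bar>A\<bar> + \<bar>a\<bar> + (\<bar>B\<bar> + \<bar>b\<bar>) * y\<^sup>2" for y
  proof -
    have "B * y\<^sup>2 \<le> \<bar>B\<bar> * y\<^sup>2" "b * y\<^sup>2 \<le> \<bar>b\<bar> * y\<^sup>2" "0 \<le> \<bar>B\<bar> * y\<^sup>2" "0 \<le> \<bar>b\<bar> * y\<^sup>2"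
      by (auto intro!: mult_right_mono)
    then show ?thesis unfolding distrib_right using \<phi>[of y] by linarith
  qed
  show int: "integrable std_gaussian \<phi>"
  proof (rule Bochner_Integration.integrable_bound[OF i])
    show "AE x in std_gaussian. norm (\<phi> x) \<le> norm (\<bar>A\<bar> + \<bar>a\<bar> + (\<bar>B\<bar> + \<bar>b\<bar>) * x\<^sup>2)"
    proof (rule AE_I2)
      fix x show "norm (\<phi> x) \<le> norm (\<bar>A\<bar> + \<bar>a\<bar> + (\<bar>B\<bar> + \<bar>b\<bar>) * x\<^sup>2)"
        using bd[of x] by simp
    qed
  qed simp
  have "(\<integral>x. - a - b * x\<^sup>2 \<partial>std_gaussian) \<le> (\<integral>x. \<phi> x \<partial>std_gaussian)"
    by (rule integral_mono) (use int \<phi> in auto)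
  then show "- a - b \<le> (\<integral>x. \<phi> x \<partial>std_gaussian)" using prob_space by simp
  have "(\<integral>x. \<phi> x \<partial>std_gaussian) \<le> (\<integral>x. A + B * x\<^sup>2 \<partial>std_gaussian)"
    by (rule integral_mono) (use int \<phi> in auto)
  then show "(\<integral>x. \<phi> x \<partial>std_gaussian) \<le> A + B" using prob_space by simp
qed

text \<open>The largest \<open>E\<close> allowed by the hypothesis is \<open>exp (x\<^sup>2 / 2 + k x)\<close> with \<open>k\<close> an infimum of
  affine functions; \<open>k\<close> is concave, hence continuous.\<close>

lemma gaussian_transport_real:
  fixes \<phi> :: "real \<Rightarrow> real" and E :: "real \<Rightarrow> ennreal"
  assumes \<phi>m: "\<phi> \<in> borel_measurable borel"
    and \<phi>: "\<And>y. - a - b * y\<^sup>2 \<le> \<phi> y" "\<And>y. \<phi> y \<le> A + B * y\<^sup>2" and b: "b < 1 / 2"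
    and E: "E \<in> borel_measurable borel"
    and le: "\<And>x y. E x \<le> ennreal (exp (\<phi> y + (x - y)\<^sup>2 / 2))"
  shows "(\<integral>\<^sup>+x. E x \<partial>std_gaussian) \<le> ennreal (exp (\<integral>x. \<phi> x \<partial>std_gaussian))"
proof -
  note [measurable] = \<phi>m E
  define L where "L = (\<lambda>x y. x * y - \<phi> y - y\<^sup>2 / 2)"
  define k where "k = (\<lambda>x. - (SUP y. L x y))"
  \<comment> \<open>\<open>e\<close> is the part of the quadratic cost left over by the lower bound
    on \<open>\<phi>\<close>. It is positive because \<open>b < 1 / 2\<close>, and completing the
    square then bounds \<open>L x y\<close> uniformly in \<open>y\<close>.\<close>
  have bdd: "bdd_above (range (L x))" for x
  proof (rule bdd_aboveI2)
    fix y
    define e where "e = 1 / 2 - b"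
    have e: "e > 0" using b by (simp add: e_def)
    have "L x y \<le> a + x * y - e * y\<^sup>2"
      using \<phi>(1)[of y] by (simp add: L_def e_def algebra_simps)
    also have "\<dots> = a + x\<^sup>2 / (4 * e) - e * (y - x / (2 * e))\<^sup>2"
      using e by (simp add: power2_eq_square field_simps)
    also have "\<dots> \<le> a + x\<^sup>2 / (4 * e)" using e by simp
    finally show "L x y \<le> a + x\<^sup>2 / (4 * (1 / 2 - b))" by (simp add: e_def)
  qed
  have Lk: "L x y \<le> - k x" for x y
    unfolding k_def using cSUP_upper[of y UNIV "L x"] bdd by simp
  have "convex_on UNIV (\<lambda>x. - k x)"
  proof (rule convex_onI)
    fix t x z :: real assume t: "0 < t" "t < 1"
    show "- k ((1 - t) *\<^sub>R x + t *\<^sub>R z) \<le> (1 - t) * - k x + t * - k z"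
    proof -
      have "L ((1 - t) *\<^sub>R x + t *\<^sub>R z) y \<le> (1 - t) * - k x + t * - k z" for y
      proof -
        have "L ((1 - t) *\<^sub>R x + t *\<^sub>R z) y = (1 - t) * L x y + t * L z y"
          by (simp add: L_def algebra_simps) (simp add: field_simps)
        also have "\<dots> \<le> (1 - t) * - k x + t * - k z"
          using t by (intro add_mono mult_left_mono Lk) auto
        finally show ?thesis .
      qed
      then have "(SUP y. L ((1 - t) *\<^sub>R x + t *\<^sub>R z) y) \<le> (1 - t) * - k x + t * - k z"
        by (intro cSUP_least) auto
      then show ?thesis by (simp add: k_def)
    qed
  qed simp
  then have "continuous_on UNIV (\<lambda>x. - (- k x))"
    by (intro continuous_on_minus convex_on_continuous) auto
  then have kc: "continuous_on UNIV k" by simp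
  \<comment> \<open>The value 0 is set apart because the comparison goes through the logarithm of
    \<open>E x\<close>.\<close>
  have "E x \<le> ennreal (exp (k x + x\<^sup>2 / 2))" for x
  proof (cases "E x = 0")
    case False
    have "E x \<noteq> \<top>" using le[of x 0] by (auto simp: top_unique)
    then obtain e where e: "e > 0" "E x = ennreal e"
      using False by (metis ennreal_cases ennreal_eq_0_iff linorder_not_less)
    have "L x y \<le> x\<^sup>2 / 2 - ln e" for y
    proof -
      have "e \<le> exp (\<phi> y + (x - y)\<^sup>2 / 2)" using le[of x y] e by simp
      then have "ln e \<le> \<phi> y + (x - y)\<^sup>2 / 2" using e by (metis exp_gt_zero ln_exp ln_le_cancel_iff)
      then show ?thesis by (simp add: L_def power2_eq_square field_simps)
    qed
    then have "(SUP y. L x y) \<le> x\<^sup>2 / 2 - ln e" by (intro cSUP_least) auto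
    then have "ln e \<le> k x + x\<^sup>2 / 2" by (simp add: k_def)
    then have "e \<le> exp (k x + x\<^sup>2 / 2)" using e by (metis exp_le_cancel_iff exp_ln)
    then show ?thesis using e by (simp add: ennreal_leI)
  qed simp
  note Ek = this
  have "(\<integral>\<^sup>+x. E x \<partial>std_gaussian) = (\<integral>\<^sup>+x. ennreal (std_normal_density x) * E x \<partial>lborel)"
    by (simp add: nn_integral_density)
  also have "\<dots> \<le> (\<integral>\<^sup>+x. ennreal (exp (k x) / sqrt (2 * pi)) \<partial>lborel)"
  proof (rule nn_integral_mono)
    fix x :: real
    have "ennreal (std_normal_density x) * E x
        \<le> ennreal (std_normal_density x) * ennreal (exp (k x + x\<^sup>2 / 2))"
      by (intro mult_left_mono Ek) simp
    also have "\<dots> = ennreal (exp (k x) / sqrt (2 * pi))"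
      by (simp add: ennreal_mult'[symmetric] std_normal_density_def exp_add[symmetric] field_simps
            exp_minus)
    finally show "ennreal (std_normal_density x) * E x \<le> ennreal (exp (k x) / sqrt (2 * pi))" .
  qed
  also have "\<dots> \<le> ennreal (exp (\<integral>x. \<phi> x \<partial>std_gaussian))"
  proof (rule gaussian_transport_continuous[OF kc])
    show "integrable std_gaussian \<phi>" by (rule integrable_quadratic_bound(1)[OF \<phi>m \<phi>])
    show "k x + x * y \<le> \<phi> y + y\<^sup>2 / 2" for x y
      using Lk[of x y] by (simp add: L_def)
  qed
  finally show ?thesis .
qed

section \<open>Tensorization\<close>

interpretation gaussian_product: product_sigma_finite "\<lambda>_. std_gaussian"
  by (intro product_sigma_finite.intro prob_space_imp_sigma_finite prob_space_std_gaussian)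

lemma prob_space_PiM_std_gaussian: "prob_space (PiM I (\<lambda>_. std_gaussian))"
  by (intro prob_space_PiM prob_space_std_gaussian)

lemma integrable_PiM_std_gaussian_square:
  assumes "i \<in> I"
  shows "integrable (PiM I (\<lambda>_. std_gaussian)) (\<lambda>x. (x i)\<^sup>2)"
proof -
  have "integrable (distr (PiM I (\<lambda>_. std_gaussian)) std_gaussian (\<lambda>\<omega>. \<omega> i)) (\<lambda>x. x\<^sup>2)"
    using distr_PiM_component[OF prob_space_std_gaussian assms] integrable_std_gaussian_square by simp
  then show ?thesis using assms by (subst (asm) integrable_distr_eq) auto
qed

lemma integrable_PiM_quadratic_bound:
  fixes \<phi> :: "('i \<Rightarrow> real) \<Rightarrow> real"
  assumes m: "\<phi> \<in> borel_measurable (PiM I (\<lambda>_. std_gaussian))"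
    and bd: "\<And>x. x \<in> space (PiM I (\<lambda>_. std_gaussian)) \<Longrightarrow> \<bar>\<phi> x\<bar> \<le> A + C * (\<Sum>i\<in>I. (x i)\<^sup>2)"
  shows "integrable (PiM I (\<lambda>_. std_gaussian)) \<phi>"
proof (rule Bochner_Integration.integrable_bound[OF _ m])
  interpret prob_space "PiM I (\<lambda>_. std_gaussian)" by (rule prob_space_PiM_std_gaussian)
  show "integrable (PiM I (\<lambda>_. std_gaussian)) (\<lambda>x. A + C * (\<Sum>i\<in>I. (x i)\<^sup>2))"
    by (intro Bochner_Integration.integrable_add integrable_mult_right
        Bochner_Integration.integrable_sum integrable_PiM_std_gaussian_square) simp_all
  show "AE x in PiM I (\<lambda>_. std_gaussian). norm (\<phi> x) \<le> norm (A + C * (\<Sum>i\<in>I. (x i)\<^sup>2))"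
    using bd by (intro AE_I2) (fastforce simp: real_norm_def)
qed

text \<open>The hypothesis tensorizes: integrating out one coordinate of \<open>E\<close> on the left and of \<open>\<phi>\<close> on
  the right reproduces it in the remaining coordinates.\<close>

theorem gaussian_transport_PiM:
  fixes \<phi> :: "('i \<Rightarrow> real) \<Rightarrow> real" and E :: "('i \<Rightarrow> real) \<Rightarrow> ennreal"
  assumes "finite I" and b: "0 \<le> b" "b < 1 / 2" and B: "0 \<le> B"
    and "\<phi> \<in> borel_measurable (PiM I (\<lambda>_. std_gaussian))"
    and "E \<in> borel_measurable (PiM I (\<lambda>_. std_gaussian))"
    and "\<And>y. y \<in> space (PiM I (\<lambda>_. std_gaussian)) \<Longrightarrow> - A - b * (\<Sum>i\<in>I. (y i)\<^sup>2) \<le> \<phi> y"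
    and "\<And>y. y \<in> space (PiM I (\<lambda>_. std_gaussian)) \<Longrightarrow> \<phi> y \<le> A + B * (\<Sum>i\<in>I. (y i)\<^sup>2)"
    and "\<And>x y. x \<in> space (PiM I (\<lambda>_. std_gaussian)) \<Longrightarrow> y \<in> space (PiM I (\<lambda>_. std_gaussian)) \<Longrightarrow>
      E x \<le> ennreal (exp (\<phi> y + (\<Sum>i\<in>I. (x i - y i)\<^sup>2) / 2))"
  shows "(\<integral>\<^sup>+x. E x \<partial>PiM I (\<lambda>_. std_gaussian)) \<le> ennreal (exp (\<integral>x. \<phi> x \<partial>PiM I (\<lambda>_. std_gaussian)))"
  using assms(1,5-)
proof (induction I arbitrary: \<phi> E A rule: finite_induct)
  case empty
  show ?case
    \<comment> \<open>An empty product has this single point; comparing it with itself is the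
      claim.\<close>
    using empty(5)[of "\<lambda>_. undefined" "\<lambda>_. undefined"]
    by (simp add: PiM_empty nn_integral_count_space_finite lebesgue_integral_count_space_finite)
next
  case (insert i I)
  let ?P = "\<lambda>I. PiM I (\<lambda>_. std_gaussian)"
  note [measurable] = insert.prems(1,2)
  note \<phi>_lower = insert.prems(3) and \<phi>_upper = insert.prems(4) and le = insert.prems(5)
  have upd: "x(i := t) \<in> space (?P (insert i I))" if "x \<in> space (?P I)" for x and t :: real
    using that by (auto simp: space_PiM PiE_def extensional_def)
  have sq: "(\<Sum>j\<in>insert i I. ((x(i := s)) j)\<^sup>2) = s\<^sup>2 + (\<Sum>j\<in>I. (x j)\<^sup>2)" for x and s :: real
    using insert(1,2) by (auto intro!: sum.cong)
  have sqd: "(\<Sum>j\<in>insert i I. ((x(i := s)) j - (y(i := t)) j)\<^sup>2) = (s - t)\<^sup>2 + (\<Sum>j\<in>I. (x j - y j)\<^sup>2)"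
    for x y and s t :: real
    using insert(1,2) by (auto intro!: sum.cong)
  have addm[measurable]: "(\<lambda>(x, t). x(i := t)) \<in> ?P I \<Otimes>\<^sub>M std_gaussian \<rightarrow>\<^sub>M ?P (insert i I)"
    by (rule measurable_add_dim)
  have updm[measurable]: "(\<lambda>t. x(i := t)) \<in> borel \<rightarrow>\<^sub>M ?P (insert i I)" if "x \<in> space (?P I)" for x
  proof -
    have "(\<lambda>t. (\<lambda>(x, t). x(i := t)) (x, t)) \<in> std_gaussian \<rightarrow>\<^sub>M ?P (insert i I)"
      using that by (intro measurable_compose[OF _ addm]) measurable
    then show ?thesis by simp
  qed
  define \<Phi> where "\<Phi> = (\<lambda>x. \<integral>t. \<phi> (x(i := t)) \<partial>std_gaussian)"
  define \<Psi> where "\<Psi> = (\<lambda>x. \<integral>\<^sup>+t. E (x(i := t)) \<partial>std_gaussian)"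
  have \<phi>m1: "(\<lambda>t. \<phi> (x(i := t))) \<in> borel_measurable borel" if "x \<in> space (?P I)" for x
    using that by measurable
  have Em1: "(\<lambda>t. E (x(i := t))) \<in> borel_measurable borel" if "x \<in> space (?P I)" for x
    using that by measurable
  have l1: "- (A + b * (\<Sum>j\<in>I. (x j)\<^sup>2)) - b * t\<^sup>2 \<le> \<phi> (x(i := t))"
    and u1: "\<phi> (x(i := t)) \<le> A + B * (\<Sum>j\<in>I. (x j)\<^sup>2) + B * t\<^sup>2" if "x \<in> space (?P I)" for x t
    using \<phi>_lower[of "x(i := t)"] \<phi>_upper[of "x(i := t)"] upd[OF that, of t] unfolding sq
    by (simp_all add: distrib_left del: fun_upd_apply)
  note \<phi>1 = integrable_quadratic_bound[OF \<phi>m1 l1 u1]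
  have "(\<integral>\<^sup>+x. E x \<partial>?P (insert i I)) = (\<integral>\<^sup>+x. \<Psi> x \<partial>?P I)"
    unfolding \<Psi>_def by (rule gaussian_product.product_nn_integral_insert) (use insert in auto)
  also have "\<dots> \<le> ennreal (exp (\<integral>x. \<Phi> x \<partial>?P I))"
  \<comment> \<open>The integrated coordinate adds \<open>b\<close> to the lower constant and
    \<open>B\<close> to the upper one. The slopes stay the same, so \<open>b < 1 / 2\<close> is
    preserved, and only the additive constant has to be general in the induction.\<close>
  proof (rule insert.IH[where A = "A + b + B"])
    show "\<Phi> \<in> borel_measurable (?P I)"
      unfolding \<Phi>_def
      by (rule sigma_finite_measure.borel_measurable_lebesgue_integral
          [OF gaussian_product.sigma_finite_measures])
         (use measurable_compose[OF addm insert.prems(1)] in \<open>simp add: case_prod_beta'\<close>)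
    show "\<Psi> \<in> borel_measurable (?P I)"
      unfolding \<Psi>_def
      by (rule sigma_finite_measure.borel_measurable_nn_integral
          [OF gaussian_product.sigma_finite_measures])
         (use measurable_compose[OF addm insert.prems(2)] in \<open>simp add: case_prod_beta'\<close>)
  next
    fix x assume x: "x \<in> space (?P I)"
    show "- (A + b + B) - b * (\<Sum>j\<in>I. (x j)\<^sup>2) \<le> \<Phi> x"
      using \<phi>1(2)[OF x x x] B by (simp add: \<Phi>_def)
    show "\<Phi> x \<le> A + b + B + B * (\<Sum>j\<in>I. (x j)\<^sup>2)"
      using \<phi>1(3)[OF x x x] b by (simp add: \<Phi>_def)
  next
    fix x y assume xy: "x \<in> space (?P I)" "y \<in> space (?P I)"
    \<comment> \<open>For fixed \<open>x\<close> and \<open>y\<close> the distance in the other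
      coordinates is a constant, absorbed into the function to which the one-dimensional inequality
      is applied.\<close>
    define d where "d = (\<Sum>j\<in>I. (x j - y j)\<^sup>2) / 2"
    have "\<Psi> x \<le> ennreal (exp (\<integral>t. \<phi> (y(i := t)) + d \<partial>std_gaussian))"
      unfolding \<Psi>_def
    proof (rule gaussian_transport_real[OF _ _ _ b(2)])
      show "(\<lambda>t. \<phi> (y(i := t)) + d) \<in> borel_measurable borel"
        using \<phi>m1[OF xy(2)] by measurable
      show "- (A + b * (\<Sum>j\<in>I. (y j)\<^sup>2) - d) - b * t\<^sup>2 \<le> \<phi> (y(i := t)) + d" for t
        using l1[OF xy(2), of t] by simp
      show "\<phi> (y(i := t)) + d \<le> (A + B * (\<Sum>j\<in>I. (y j)\<^sup>2) + d) + B * t\<^sup>2" for t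
        using u1[OF xy(2), of t] by simp
      show "(\<lambda>t. E (x(i := t))) \<in> borel_measurable borel" by (rule Em1[OF xy(1)])
      show "E (x(i := s)) \<le> ennreal (exp (\<phi> (y(i := t)) + d + (s - t)\<^sup>2 / 2))" for s t
        using le[of "x(i := s)" "y(i := t)"] upd[OF xy(1), of s] upd[OF xy(2), of t] unfolding sqd
        by (simp add: d_def add_divide_distrib algebra_simps del: fun_upd_apply)
    qed
    also have "(\<integral>t. \<phi> (y(i := t)) + d \<partial>std_gaussian) = \<Phi> y + d"
    proof -
      interpret prob_space std_gaussian by (rule prob_space_std_gaussian)
      show ?thesis using \<phi>1(1)[OF xy(2) xy(2) xy(2)] prob_space by (simp add: \<Phi>_def)
    qed
    finally show "\<Psi> x \<le> ennreal (exp (\<Phi> y + (\<Sum>j\<in>I. (x j - y j)\<^sup>2) / 2))"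
      by (simp add: d_def)
  qed
  also have "(\<integral>x. \<Phi> x \<partial>?P I) = (\<integral>x. \<phi> x \<partial>?P (insert i I))"
    unfolding \<Phi>_def
  proof (rule gaussian_product.product_integral_insert[symmetric, OF insert(1,2)])
    show "integrable (?P (insert i I)) \<phi>"
    proof (rule integrable_PiM_quadratic_bound[OF insert.prems(1)])
      fix x assume x: "x \<in> space (?P (insert i I))"
      have "0 \<le> b * (\<Sum>j\<in>insert i I. (x j)\<^sup>2)" "0 \<le> B * (\<Sum>j\<in>insert i I. (x j)\<^sup>2)"
        using b B by (auto intro!: mult_nonneg_nonneg sum_nonneg)
      then show "\<bar>\<phi> x\<bar> \<le> A + (b + B) * (\<Sum>j\<in>insert i I. (x j)\<^sup>2)"
        unfolding distrib_right using \<phi>_lower[OF x] \<phi>_upper[OF x] by linarith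
    qed
  qed
  finally show ?case .
qed

section \<open>Squares of Lipschitz functions of a Gaussian vector\<close>

text \<open>Reconciles the density, a product over the index type, with Lebesgue measure, which
  factors over \<open>Basis\<close>.\<close>

lemma prod_Basis_vec:
  fixes x :: "real ^ 'n"
  shows "(\<Prod>i\<in>UNIV. f (x $ i)) = (\<Prod>b\<in>Basis. f (x \<bullet> b))"
proof -
  have "bij_betw (\<lambda>i. axis i (1::real)) (UNIV :: 'n set) (Basis :: (real ^ 'n) set)"
    by (auto simp: bij_betw_def inj_on_def axis_eq_axis Basis_vec_def)
  from prod.reindex_bij_betw[OF this, of "\<lambda>b. f (x \<bullet> b)"] show ?thesis
    by (simp add: inner_axis)
qed

lemma std_gaussian_vector_measurable:
  "std_gaussian_vector M h \<Longrightarrow> h \<in> borel_measurable M"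
  by (auto simp: std_gaussian_vector_def dest: distributed_measurable)

text \<open>Boxes determine the product measure, and on a box both the density and the indicator
  factor over the coordinates. This transfers the tensorized inequality to the law of
  \<open>h\<close>.\<close>

lemma std_gaussian_vector_coordinates:
  fixes h :: "'w \<Rightarrow> real ^ 'n"
  assumes h: "std_gaussian_vector M h"
  shows "distr M (PiM Basis (\<lambda>_. std_gaussian)) (\<lambda>\<omega>. \<lambda>b\<in>Basis. h \<omega> \<bullet> b) = PiM Basis (\<lambda>_. std_gaussian)"
    (is "distr M ?P ?X = ?P")
proof (rule gaussian_product.PiM_eqI)
  have hm[measurable]: "h \<in> borel_measurable M" by (rule std_gaussian_vector_measurable[OF h])
  have X: "?X \<in> M \<rightarrow>\<^sub>M ?P"
    by (rule measurable_restrict) simp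
  fix A :: "real ^ 'n \<Rightarrow> real set"
  assume "\<And>b. b \<in> Basis \<Longrightarrow> A b \<in> sets std_gaussian"
  then have [measurable]: "b \<in> Basis \<Longrightarrow> A b \<in> sets borel" for b by simp
  define S where "S = {x :: real ^ 'n. \<forall>b\<in>Basis. x \<bullet> b \<in> A b}"
  have "S = (\<Inter>b\<in>Basis. (\<lambda>x. x \<bullet> b) -` A b \<inter> space borel)" by (auto simp: S_def)
  moreover have "(\<lambda>x. x \<bullet> b) -` A b \<inter> space borel \<in> sets (borel :: (real ^ 'n) measure)" if "b \<in> Basis" for b
    using that by (intro measurable_sets[of _ _ borel]) simp_all
  ultimately have S[measurable]: "S \<in> sets borel"
    by (auto intro!: sets.finite_INT)
  have "emeasure (distr M ?P ?X) (Pi\<^sub>E Basis A) = emeasure M (?X -` Pi\<^sub>E Basis A \<inter> space M)"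
    by (rule emeasure_distr[OF X]) (simp add: sets_PiM_I_finite)
  also have "?X -` Pi\<^sub>E Basis A \<inter> space M = h -` S \<inter> space M"
    by (auto simp: S_def PiE_iff)
  also have "emeasure M \<dots> = emeasure (distr M lborel h) S"
    by (subst emeasure_distr) simp_all
  also have "\<dots> = emeasure (density lborel (\<lambda>x. ennreal (\<Prod>i\<in>UNIV. std_normal_density (x $ i)))) S"
    using h by (simp add: std_gaussian_vector_def distributed_distr_eq_density)
  also have "\<dots> = (\<integral>\<^sup>+x. ennreal (\<Prod>b\<in>Basis. std_normal_density (x \<bullet> b)) * indicator S x \<partial>lborel)"
    unfolding prod_Basis_vec by (rule emeasure_density) simp_all
  also have "\<dots> = (\<integral>\<^sup>+x. (\<Prod>b\<in>Basis. ennreal (std_normal_density (x \<bullet> b)) * indicator (A b) (x \<bullet> b)) \<partial>lborel)"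
  proof (rule nn_integral_cong)
    fix x :: "real ^ 'n"
    have "indicator S x = (\<Prod>b\<in>Basis. indicator (A b) (x \<bullet> b) :: ennreal)"
      by (auto simp: S_def indicator_def)
    then show "ennreal (\<Prod>b\<in>Basis. std_normal_density (x \<bullet> b)) * indicator S x
      = (\<Prod>b\<in>Basis. ennreal (std_normal_density (x \<bullet> b)) * indicator (A b) (x \<bullet> b))"
      by (simp add: prod.distrib prod_ennreal)
  qed
  also have "\<dots> = (\<Prod>b\<in>Basis. \<integral>\<^sup>+x. ennreal (std_normal_density x) * indicator (A b) x \<partial>lborel)"
    by (rule nn_integral_lborel_prod) simp_all
  also have "\<dots> = (\<Prod>b\<in>Basis. emeasure std_gaussian (A b))"
    by (intro prod.cong refl emeasure_density[symmetric]) simp_all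
  finally show "emeasure (distr M ?P ?X) (Pi\<^sub>E Basis A) = (\<Prod>b\<in>Basis. emeasure std_gaussian (A b))" .
qed simp_all

text \<open>The gap is a perfect square divided by \<open>e\<close>. A small \<open>e\<close> leaves
  the weight of \<open>y^2\<close> close to 1, which is what a negative multiple of
  \<open>g^2\<close> requires in order to stay within \<open>b < 1 / 2\<close>.\<close>

lemma square_le_weighted:
  fixes x y :: real
  assumes "e > 0"
  shows "(x + y)\<^sup>2 \<le> (1 + 1 / e) * x\<^sup>2 + (1 + e) * y\<^sup>2"
proof -
  have "(1 + 1 / e) * x\<^sup>2 + (1 + e) * y\<^sup>2 - (x + y)\<^sup>2 = (x - e * y)\<^sup>2 / e"
    using assms by (simp add: power2_eq_square field_simps)
  then show ?thesis using assms by (smt (verit) divide_nonneg_pos zero_le_power2)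
qed

text \<open>The case \<open>\<phi> = c g\<^sup>2\<close>, \<open>c = l / (1 - 2 l)\<close>, of the transport inequality: the infimal
  convolution of \<open>c b\<^sup>2\<close> with half the square distance is \<open>l a\<^sup>2\<close>, for either sign of \<open>l\<close>.\<close>

theorem gaussian_lipschitz_square_mgf:
  fixes h :: "'w \<Rightarrow> real ^ 'n" and g :: "real ^ 'n \<Rightarrow> real"
  assumes h: "std_gaussian_vector M h"
    and g: "\<And>x y. \<bar>g x - g y\<bar> \<le> norm (x - y)"
    and l: "l < 1 / 2"
  shows "(\<integral>\<^sup>+\<omega>. ennreal (exp (l * (g (h \<omega>))\<^sup>2)) \<partial>M)
    \<le> ennreal (exp (l / (1 - 2 * l) * (\<integral>\<omega>. (g (h \<omega>))\<^sup>2 \<partial>M)))"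
proof -
  let ?P = "PiM (Basis :: (real ^ 'n) set) (\<lambda>_. std_gaussian)"
  define c where "c = l / (1 - 2 * l)"
  define u where "u = 1 - 2 * l"
  have u: "u > 0" using l by (simp add: u_def)
  have "c = (1 - u) / 2 / u" by (simp add: c_def u_def)
  then have c12: "c + 1 / 2 = 1 / (2 * u)" using u by (simp add: field_simps)
  have "1 / (2 * u) > 0" using u by simp
  with c12 have c: "c > - 1 / 2" by linarith
  define Z :: "(real ^ 'n \<Rightarrow> real) \<Rightarrow> real ^ 'n" where "Z = (\<lambda>x. \<Sum>b\<in>Basis. x b *\<^sub>R b)"
  have hm[measurable]: "h \<in> borel_measurable M" by (rule std_gaussian_vector_measurable[OF h])
  have "1-lipschitz_on UNIV g"
    using g by (intro lipschitz_onI) (auto simp: dist_norm)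
  then have gm[measurable]: "g \<in> borel_measurable borel"
    by (intro borel_measurable_continuous_onI lipschitz_on_continuous_on)
  have Zm[measurable]: "Z \<in> ?P \<rightarrow>\<^sub>M borel"
    unfolding Z_def by (intro borel_measurable_sum borel_measurable_scaleR
      measurable_component_singleton[where M = "\<lambda>_. std_gaussian", simplified] borel_measurable_const)
  have X[measurable]: "(\<lambda>\<omega>. \<lambda>b\<in>Basis. h \<omega> \<bullet> b) \<in> M \<rightarrow>\<^sub>M ?P"
    by (rule measurable_restrict) simp
  have Zh: "Z (\<lambda>b\<in>Basis. h \<omega> \<bullet> b) = h \<omega>" for \<omega>
    by (simp add: Z_def euclidean_representation)
  have Zi: "Z x \<bullet> b = x b" if "b \<in> Basis" for x b
    using that by (simp add: Z_def inner_sum_left inner_Basis if_distrib sum.delta cong: if_cong)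
  have normZ: "(norm (Z x - Z y))\<^sup>2 = (\<Sum>b\<in>Basis. (x b - y b)\<^sup>2)" for x y
    unfolding power2_norm_eq_inner by (subst euclidean_inner) (simp add: Zi inner_diff_left power2_eq_square)
  have normZ0: "(norm (Z x))\<^sup>2 = (\<Sum>b\<in>Basis. (x b)\<^sup>2)" for x
    unfolding power2_norm_eq_inner by (subst euclidean_inner) (simp add: Zi power2_eq_square)
  have g2: "(g z)\<^sup>2 \<le> (1 + 1 / e) * (g 0)\<^sup>2 + (1 + e) * (norm z)\<^sup>2" if "e > 0" for z e
  proof -
    have "\<bar>g z\<bar> \<le> \<bar>g 0\<bar> + norm z" using g[of z 0] by simp
    then have "(g z)\<^sup>2 \<le> (\<bar>g 0\<bar> + norm z)\<^sup>2" by (metis abs_ge_zero power2_abs power_mono)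
    also have "\<dots> \<le> (1 + 1 / e) * (g 0)\<^sup>2 + (1 + e) * (norm z)\<^sup>2"
      using square_le_weighted[OF that, of "\<bar>g 0\<bar>" "norm z"] by simp
    finally show ?thesis .
  qed
  \<comment> \<open>The growth condition of the transport inequality. It is delicate only for
    negative \<open>c\<close>, where \<open>- c < 1 / 2\<close> leaves little room.\<close>
  obtain A b where b: "0 \<le> b" "b < 1 / 2" and A: "0 \<le> A" "\<And>z. - A - b * (norm z)\<^sup>2 \<le> c * (g z)\<^sup>2"
  proof (cases "c \<ge> 0")
    case True
    show ?thesis by (rule that[of 0 0]) (use True in auto)
  next
    case False
    \<comment> \<open>Chosen so that \<open>- c * (1 + e)\<close> is the midpoint of
      \<open>- c\<close> and \<open>1 / 2\<close>.\<close>
    define e where "e = (1 / (- 2 * c) - 1) / 2"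
    have e: "e > 0" using c False by (simp add: e_def field_simps)
    have "- c * (1 + e) = (- c + 1 / 2) / 2"
      unfolding e_def using False by (simp add: field_simps)
    also have "\<dots> < 1 / 2" using c by simp
    finally have ce: "- c * (1 + e) < 1 / 2" .
    show ?thesis
    proof (rule that[of "- c * (1 + e)" "- c * ((1 + 1 / e) * (g 0)\<^sup>2)"])
      show "0 \<le> - c * (1 + e)" "0 \<le> - c * ((1 + 1 / e) * (g 0)\<^sup>2)"
        using False e by (intro mult_nonneg_nonneg; simp)+
      fix z
      have "c * ((1 + 1 / e) * (g 0)\<^sup>2 + (1 + e) * (norm z)\<^sup>2) \<le> c * (g z)\<^sup>2"
        using g2[OF e, of z] False by (intro mult_left_mono_neg) auto
      then show "- (- c * ((1 + 1 / e) * (g 0)\<^sup>2)) - - c * (1 + e) * (norm z)\<^sup>2 \<le> c * (g z)\<^sup>2"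
        by (simp add: algebra_simps)
    qed (rule ce)
  qed
  have up: "c * (g z)\<^sup>2 \<le> 2 * \<bar>c\<bar> * (g 0)\<^sup>2 + 2 * \<bar>c\<bar> * (norm z)\<^sup>2" for z
  proof -
    have "c * (g z)\<^sup>2 \<le> \<bar>c\<bar> * (g z)\<^sup>2" by (intro mult_right_mono) auto
    also have "\<dots> \<le> \<bar>c\<bar> * (2 * (g 0)\<^sup>2 + 2 * (norm z)\<^sup>2)"
      using g2[of 1 z] by (intro mult_left_mono) auto
    finally show ?thesis by (simp add: algebra_simps)
  qed
  have "(\<integral>\<^sup>+x. ennreal (exp (l * (g (Z x))\<^sup>2)) \<partial>?P) \<le> ennreal (exp (\<integral>x. c * (g (Z x))\<^sup>2 \<partial>?P))"
  proof (rule gaussian_transport_PiM[where b = b and B = "2 * \<bar>c\<bar>" and A = "A + 2 * \<bar>c\<bar> * (g 0)\<^sup>2"])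
    fix x y :: "real ^ 'n \<Rightarrow> real"
    have nn: "0 \<le> 2 * \<bar>c\<bar> * (g 0)\<^sup>2" by simp
    show "- (A + 2 * \<bar>c\<bar> * (g 0)\<^sup>2) - b * (\<Sum>b\<in>Basis. (y b)\<^sup>2) \<le> c * (g (Z y))\<^sup>2"
      using A(2)[of "Z y"] nn unfolding normZ0 by linarith
    show "c * (g (Z y))\<^sup>2 \<le> A + 2 * \<bar>c\<bar> * (g 0)\<^sup>2 + 2 * \<bar>c\<bar> * (\<Sum>b\<in>Basis. (y b)\<^sup>2)"
      using up[of "Z y"] A(1) unfolding normZ0 by linarith
    \<comment> \<open>Since \<open>c + 1 / 2 = 1 / (2 * u)\<close>, the quadratic form in
      \<open>p\<close> and \<open>q\<close> is exactly the square
      \<open>(q - u * p)^2 / (2 * u)\<close>. This is what determines \<open>c\<close> from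
      \<open>l\<close>.\<close>
    define p q where "p = g (Z x)" and "q = g (Z y)"
    have "(p - q)\<^sup>2 \<le> (norm (Z x - Z y))\<^sup>2"
      using g[of "Z x" "Z y"] by (metis p_def q_def abs_ge_zero power2_abs power_mono)
    moreover have "c * q\<^sup>2 + (p - q)\<^sup>2 / 2 - l * p\<^sup>2 = (c + 1 / 2) * q\<^sup>2 - p * q + u / 2 * p\<^sup>2"
      by (simp add: u_def power2_eq_square field_simps)
    moreover have "\<dots> = (q - u * p)\<^sup>2 / (2 * u)"
      unfolding c12 using u by (simp add: power2_eq_square field_simps)
    moreover have "0 \<le> (q - u * p)\<^sup>2 / (2 * u)" using u by simp
    ultimately have "l * p\<^sup>2 \<le> c * q\<^sup>2 + (norm (Z x - Z y))\<^sup>2 / 2" by linarith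
    then show "ennreal (exp (l * (g (Z x))\<^sup>2))
        \<le> ennreal (exp (c * (g (Z y))\<^sup>2 + (\<Sum>b\<in>Basis. (x b - y b)\<^sup>2) / 2))"
      by (simp add: p_def q_def normZ ennreal_leI)
  qed (use b in auto)
  also have "(\<integral>\<^sup>+x. ennreal (exp (l * (g (Z x))\<^sup>2)) \<partial>?P) = (\<integral>\<^sup>+\<omega>. ennreal (exp (l * (g (h \<omega>))\<^sup>2)) \<partial>M)"
    by (subst std_gaussian_vector_coordinates[OF h, symmetric]) (simp add: nn_integral_distr Zh)
  also have "(\<integral>x. c * (g (Z x))\<^sup>2 \<partial>?P) = (\<integral>\<omega>. c * (g (h \<omega>))\<^sup>2 \<partial>M)"
    by (subst std_gaussian_vector_coordinates[OF h, symmetric]) (simp add: integral_distr Zh)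
  finally show ?thesis by (simp add: c_def)
qed

lemma integrable_norm_std_gaussian_vector:
  fixes h :: "'w \<Rightarrow> real ^ 'n"
  assumes h: "std_gaussian_vector M h"
  shows "integrable M (\<lambda>\<omega>. (norm (h \<omega>))\<^sup>2)"
proof -
  let ?P = "PiM (Basis :: (real ^ 'n) set) (\<lambda>_. std_gaussian)"
  have [measurable]: "h \<in> borel_measurable M" by (rule std_gaussian_vector_measurable[OF h])
  have X[measurable]: "(\<lambda>\<omega>. \<lambda>b\<in>Basis. h \<omega> \<bullet> b) \<in> M \<rightarrow>\<^sub>M ?P"
    by (rule measurable_restrict) simp
  have "integrable M (\<lambda>\<omega>. (h \<omega> \<bullet> b)\<^sup>2)" if b: "b \<in> Basis" for b
  proof -
    have "integrable (distr M ?P (\<lambda>\<omega>. \<lambda>b\<in>Basis. h \<omega> \<bullet> b)) (\<lambda>x. (x b)\<^sup>2)"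
      unfolding std_gaussian_vector_coordinates[OF h] by (rule integrable_PiM_std_gaussian_square[OF b])
    then show ?thesis using b by (subst (asm) integrable_distr_eq) auto
  qed
  then have "integrable M (\<lambda>\<omega>. \<Sum>b\<in>Basis. (h \<omega> \<bullet> b)\<^sup>2)"
    by (intro Bochner_Integration.integrable_sum)
  moreover have "(norm (h \<omega>))\<^sup>2 = (\<Sum>b\<in>Basis. (h \<omega> \<bullet> b)\<^sup>2)" for \<omega>
    unfolding power2_norm_eq_inner by (subst euclidean_inner) (simp add: power2_eq_square)
  ultimately show ?thesis by simp
qed

section \<open>Sub-gamma random variables\<close>

text \<open>With \<open>y = \<bar>x\<bar> / 2\<close>, the Taylor bound \<open>s\<close> for
  \<open>exp y\<close> gives \<open>exp y - exp (- y) \<ge> s - 1 / s \<ge> 2 * y\<close>. Squaring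
  and the double-angle identity finish.\<close>

lemma cosh_ge_quadratic: "1 + x\<^sup>2 / 2 \<le> (exp x + exp (- x)) / (2 :: real)"
proof -
  define y where "y = \<bar>x\<bar> / 2"
  have y: "0 \<le> y" by (simp add: y_def)
  define s where "s = 1 + y + y\<^sup>2 / 2"
  have s: "1 \<le> s" "s \<le> exp y"
    using y exp_lower_Taylor_quadratic[OF y] by (simp_all add: s_def)
  have "2 * y * s \<le> s * s - 1"
  proof -
    have "s * s - 1 - 2 * y * s = y ^ 4 / 4"
      unfolding s_def by (simp add: power2_eq_square power4_eq_xxxx field_simps)
    moreover have "0 \<le> y ^ 4 / 4" using y by simp
    ultimately show ?thesis by linarith
  qed
  then have "2 * y \<le> s - 1 / s" using s by (simp add: field_simps)
  also have "\<dots> \<le> exp y - exp (- y)"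
    using s by (intro diff_mono) (auto simp: exp_minus inverse_eq_divide frac_le)
  finally have "(2 * y)\<^sup>2 \<le> (exp y - exp (- y))\<^sup>2" using y by (intro power_mono) auto
  also have "(exp y - exp (- y))\<^sup>2 = exp (2 * y) + exp (- (2 * y)) - 2"
    by (simp add: power2_eq_square algebra_simps flip: exp_add)
  also have "exp (2 * y) + exp (- (2 * y)) = exp x + exp (- x)"
    by (cases "x \<ge> 0") (auto simp: y_def)
  finally show ?thesis by (simp add: y_def)
qed

context prob_space
begin

lemma chernoff_ge:
  fixes X :: "'a \<Rightarrow> real"
  assumes [measurable]: "X \<in> borel_measurable M"
    and int: "integrable M (\<lambda>\<omega>. exp (l * X \<omega>))" and l: "0 \<le> l"
    and le: "expectation (\<lambda>\<omega>. exp (l * X \<omega>)) \<le> exp (l * a - t)"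
  shows "prob {\<omega> \<in> space M. a \<le> X \<omega>} \<le> exp (- t)"
proof -
  have "prob {\<omega> \<in> space M. a \<le> X \<omega>} \<le> prob {\<omega> \<in> space M. exp (l * a) \<le> exp (l * X \<omega>)}"
    using l by (intro finite_measure_mono) (auto intro: mult_left_mono)
  also have "\<dots> \<le> expectation (\<lambda>\<omega>. exp (l * X \<omega>)) / exp (l * a)"
    by (rule integral_Markov_inequality_measure[OF int]) auto
  also have "\<dots> \<le> exp (l * a - t) / exp (l * a)" by (intro divide_right_mono le) simp
  also have "\<dots> = exp (- t)" by (simp flip: exp_diff)
  finally show ?thesis .
qed

text \<open>Averaging the exponential bounds at \<open>l\<close> and \<open>- l\<close> cancels the
  linear term. What remains dominates \<open>1 + l^2 / 2\<close> times the second moment; dividing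
  by \<open>l^2\<close> and letting \<open>l\<close> tend to 0 replaces differentiation under the
  integral.\<close>

lemma sub_gamma_second_moment:
  fixes X :: "'a \<Rightarrow> real"
  assumes [measurable]: "X \<in> borel_measurable M"
    and c: "0 < c" and v: "0 \<le> v"
    and int: "\<And>l. l < 1 / c \<Longrightarrow> integrable M (\<lambda>\<omega>. exp (l * X \<omega>))"
    and mgf: "\<And>l. l < 1 / c \<Longrightarrow> expectation (\<lambda>\<omega>. exp (l * X \<omega>)) \<le> exp (v * l\<^sup>2 / (2 * (1 - c * l)))"
  shows "integrable M (\<lambda>\<omega>. (X \<omega>)\<^sup>2)" and "expectation (\<lambda>\<omega>. (X \<omega>)\<^sup>2) \<le> v"
proof -
  have neg: "- l < 1 / c" if "0 < l" for l
    using that c by (smt (verit) divide_pos_pos)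
  have ch: "1 + l\<^sup>2 / 2 * (X \<omega>)\<^sup>2 \<le> (exp (l * X \<omega>) + exp (- l * X \<omega>)) / 2" for l \<omega>
    using cosh_ge_quadratic[of "l * X \<omega>"] by (simp add: power_mult_distrib)
  have i2: "integrable M (\<lambda>\<omega>. (exp (l * X \<omega>) + exp (- l * X \<omega>)) / 2)" if "0 < l" "l < 1 / c" for l
    using int[OF that(2)] int[OF neg[OF that(1)]] by simp
  show sq: "integrable M (\<lambda>\<omega>. (X \<omega>)\<^sup>2)"
  proof -
    define l where "l = 1 / (2 * c)"
    have l: "0 < l" "l < 1 / c" using c by (auto simp: l_def field_simps)
    have "integrable M (\<lambda>\<omega>. l\<^sup>2 / 2 * (X \<omega>)\<^sup>2)"
    proof (rule Bochner_Integration.integrable_bound[OF i2[OF l]])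
      show "AE \<omega> in M. norm (l\<^sup>2 / 2 * (X \<omega>)\<^sup>2) \<le> norm ((exp (l * X \<omega>) + exp (- l * X \<omega>)) / 2)"
      proof (rule AE_I2)
        fix \<omega>
        have "norm (l\<^sup>2 / 2 * (X \<omega>)\<^sup>2) = l\<^sup>2 / 2 * (X \<omega>)\<^sup>2" by simp
        also have "\<dots> \<le> (exp (l * X \<omega>) + exp (- l * X \<omega>)) / 2" using ch[of l \<omega>] by linarith
        also have "\<dots> \<le> norm \<dots>" by simp
        finally show "norm (l\<^sup>2 / 2 * (X \<omega>)\<^sup>2) \<le> norm ((exp (l * X \<omega>) + exp (- l * X \<omega>)) / 2)" .
      qed
    qed simp
    from integrable_mult_right[OF this, of "2 / l\<^sup>2"] show ?thesis using l by simp
  qed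
  define V where "V = expectation (\<lambda>\<omega>. (X \<omega>)\<^sup>2)"
  have bound: "V / 2 \<le> (v / 2 / (1 - c * l)) / (1 - v * l\<^sup>2 / 2 / (1 - c * l))"
    if l: "0 < l" "l < 1 / c" and y1: "v * l\<^sup>2 / 2 / (1 - c * l) < 1" for l
  proof -
    define y where "y = v * l\<^sup>2 / 2 / (1 - c * l)"
    have cl: "0 < 1 - c * l" using l c by (simp add: field_simps)
    have "1 + l\<^sup>2 / 2 * V = expectation (\<lambda>\<omega>. 1 + l\<^sup>2 / 2 * (X \<omega>)\<^sup>2)"
      using sq prob_space by (simp add: V_def)
    also have "\<dots> \<le> expectation (\<lambda>\<omega>. (exp (l * X \<omega>) + exp (- l * X \<omega>)) / 2)"
      by (rule integral_mono) (use sq i2[OF l] ch in auto)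
    also have "\<dots> = (expectation (\<lambda>\<omega>. exp (l * X \<omega>)) + expectation (\<lambda>\<omega>. exp (- l * X \<omega>))) / 2"
      using int[OF l(2)] int[OF neg[OF l(1)]] by simp
    also have "\<dots> \<le> (exp y + exp y) / 2"
    proof -
      have "expectation (\<lambda>\<omega>. exp (l * X \<omega>)) \<le> exp y"
        using mgf[OF l(2)] by (simp add: y_def mult.commute)
      moreover have "expectation (\<lambda>\<omega>. exp (- l * X \<omega>)) \<le> exp y"
      proof -
        \<comment> \<open>The bound at \<open>- l\<close> has the larger denominator, so the one at
          \<open>l\<close> covers both.\<close>
        have "v * l\<^sup>2 / (2 * (1 + c * l)) \<le> v * l\<^sup>2 / (2 * (1 - c * l))"
          using cl c l v by (intro divide_left_mono) (auto intro!: mult_pos_pos add_pos_pos)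
        then have "v * (- l)\<^sup>2 / (2 * (1 - c * - l)) \<le> y" by (simp add: y_def mult.commute)
        then show ?thesis using mgf[OF neg[OF l(1)]] by (meson exp_le_cancel_iff order_trans)
      qed
      ultimately show ?thesis by simp
    qed
    also have "\<dots> = exp y" by simp
    \<comment> \<open>A rational majorant of \<open>exp y\<close>: subtracting 1 leaves
      \<open>y / (1 - y)\<close>, which has an explicit factor \<open>l^2\<close>.\<close>
    also have "\<dots> \<le> 1 / (1 - y)"
    proof -
      have "1 - y \<le> exp (- y)" using exp_ge_add_one_self[of "- y"] by simp
      moreover have "0 < 1 - y" using y1 by (simp only: y_def)
      ultimately have "1 / exp (- y) \<le> 1 / (1 - y)" by (intro divide_left_mono) auto
      then show ?thesis by (simp add: exp_minus inverse_eq_divide)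
    qed
    also have "\<dots> = 1 + y / (1 - y)" using y1[folded y_def] by (simp add: field_simps)
    finally have "l\<^sup>2 / 2 * V \<le> y / (1 - y)" by simp
    also have "\<dots> = l\<^sup>2 * ((v / 2 / (1 - c * l)) / (1 - y))" by (simp add: y_def)
    finally have "l\<^sup>2 * (V / 2) \<le> l\<^sup>2 * ((v / 2 / (1 - c * l)) / (1 - y))" by simp
    then show ?thesis using l by (simp only: y_def mult_le_cancel_left) (simp add: zero_less_power)
  qed
  have "((\<lambda>l. (v / 2 / (1 - c * l)) / (1 - v * l\<^sup>2 / 2 / (1 - c * l))) \<longlongrightarrow> v / 2) (at_right 0)"
    by (auto intro!: tendsto_eq_intros)
  moreover have "\<forall>\<^sub>F l in at_right 0. V / 2 \<le> (v / 2 / (1 - c * l)) / (1 - v * l\<^sup>2 / 2 / (1 - c * l))"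
  proof -
    have "((\<lambda>l. v * l\<^sup>2 / 2 / (1 - c * l)) \<longlongrightarrow> 0) (at_right 0)"
      by (auto intro!: tendsto_eq_intros)
    then have "\<forall>\<^sub>F l in at_right 0. v * l\<^sup>2 / 2 / (1 - c * l) < 1"
      by (rule order_tendstoD) simp
    moreover have "\<forall>\<^sub>F l in at_right 0. l \<in> {0<..<1 / c}"
      using c by (intro eventually_at_right_real) simp
    ultimately show ?thesis by eventually_elim (use bound in auto)
  qed
  ultimately have "V / 2 \<le> v / 2" by (rule tendsto_lowerbound) simp
  then show "expectation (\<lambda>\<omega>. (X \<omega>)\<^sup>2) \<le> v" by (simp add: V_def)
qed

lemma sub_gamma_tail:
  fixes X :: "'a \<Rightarrow> real"
  assumes [measurable]: "X \<in> borel_measurable M"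
    and c: "0 < c" and v: "0 \<le> v" and t: "0 \<le> t"
    and int: "\<And>l. l < 1 / c \<Longrightarrow> integrable M (\<lambda>\<omega>. exp (l * X \<omega>))"
    and mgf: "\<And>l. l < 1 / c \<Longrightarrow> expectation (\<lambda>\<omega>. exp (l * X \<omega>)) \<le> exp (v * l\<^sup>2 / (2 * (1 - c * l)))"
  shows "prob {\<omega> \<in> space M. sqrt (2 * v * t) + c * t \<le> \<bar>X \<omega>\<bar>} \<le> 2 * exp (- t)"
\<comment> \<open>At \<open>t = 0\<close> the right side is 2. Afterwards the threshold
  \<open>a\<close> is positive even when \<open>v = 0\<close>.\<close>
proof (cases "t = 0")
  case True
  then show ?thesis by (simp add: prob_space)
next
  case False
  with t have t: "t > 0" by simp
  define a where "a = sqrt (2 * v * t) + c * t"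
  show ?thesis
  \<comment> \<open>The optimal parameter below divides by \<open>v\<close>. For
    \<open>v = 0\<close> the second moment vanishes, so \<open>X\<close> is 0 almost
    everywhere.\<close>
  proof (cases "v = 0")
    case True
    have sm: "integrable M (\<lambda>\<omega>. (X \<omega>)\<^sup>2)" "expectation (\<lambda>\<omega>. (X \<omega>)\<^sup>2) \<le> v"
      using sub_gamma_second_moment[OF assms(1) c v int mgf] by auto
    have "expectation (\<lambda>\<omega>. (X \<omega>)\<^sup>2) = 0"
      using sm(2) True by (intro antisym Bochner_Integration.integral_nonneg) auto
    then have "AE \<omega> in M. X \<omega> = 0"
      using sm(1) by (subst (asm) integral_nonneg_eq_0_iff_AE) auto
    then have "AE \<omega> in M. \<not> (a \<le> \<bar>X \<omega>\<bar>)"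
      using mult_pos_pos[OF c t] True by (auto simp: a_def elim!: eventually_mono)
    then have "prob {\<omega> \<in> space M. a \<le> \<bar>X \<omega>\<bar>} = 0"
      by (intro prob_eq_0[THEN iffD2]) auto
    then show ?thesis by (simp add: a_def)
  next
    case False
    with v have v: "v > 0" by simp
    \<comment> \<open>In terms of \<open>r\<close>, \<open>t = v * r^2 / 2\<close> and
      \<open>a = v * r + c * t\<close>. The minimizer of the Chernoff exponent is
      \<open>r / (1 + c * r)\<close>, and its value there is exactly \<open>- t\<close>.\<close>
    define r where "r = sqrt (2 * t / v)"
    have r: "r > 0" using t v by (simp add: r_def)
    have tr: "t = v * r\<^sup>2 / 2" using t v by (simp add: r_def)
    have ar: "a = v * r + c * t"
    proof -
      have "2 * v * t = (v * r)\<^sup>2" by (simp add: tr power2_eq_square)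
      then have "sqrt (2 * v * t) = v * r" using v r by (simp add: real_sqrt_abs)
      then show ?thesis by (simp add: a_def)
    qed
    have w: "1 + c * r > 0" using c r by (simp add: add_pos_pos)
    have upper: "prob {\<omega> \<in> space M. a \<le> X \<omega>} \<le> exp (- t)"
    proof (rule chernoff_ge[OF assms(1), of "r / (1 + c * r)"])
      have l: "r / (1 + c * r) < 1 / c" using c r w by (simp add: field_simps)
      show "integrable M (\<lambda>\<omega>. exp (r / (1 + c * r) * X \<omega>))" by (rule int[OF l])
      show "0 \<le> r / (1 + c * r)" using r w by simp
      have e1: "1 - c * (r / (1 + c * r)) = 1 / (1 + c * r)" using w by (simp add: field_simps)
      have "v * (r / (1 + c * r))\<^sup>2 / (2 * (1 - c * (r / (1 + c * r)))) = v * r\<^sup>2 / 2 / (1 + c * r)"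
        unfolding e1 using w by (simp add: power2_eq_square)
      also have "\<dots> = r / (1 + c * r) * a - t"
        unfolding ar tr using w by (simp add: divide_simps) (simp add: power2_eq_square algebra_simps)
      finally show "expectation (\<lambda>\<omega>. exp (r / (1 + c * r) * X \<omega>)) \<le> exp (r / (1 + c * r) * a - t)"
        using mgf[OF l] by simp
    qed
    \<comment> \<open>Every negative parameter is admissible, and at \<open>- r\<close> the
      denominator only helps; the Gaussian choice \<open>r\<close> suffices without
      optimization.\<close>
    have lower: "prob {\<omega> \<in> space M. a \<le> - X \<omega>} \<le> exp (- t)"
    proof (rule chernoff_ge[where l = r])
      have l: "- r < 1 / c" using c r by (smt (verit) divide_pos_pos)
      show "integrable M (\<lambda>\<omega>. exp (r * - X \<omega>))" using int[OF l] by simp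
      have "v * r\<^sup>2 / (2 * (1 + c * r)) \<le> v * r\<^sup>2 / 2"
        using v c r w by (intro divide_left_mono) auto
      also have "\<dots> \<le> r * a - t"
      proof -
        have "r * a - t = v * r\<^sup>2 + c * (r * t) - t"
          unfolding ar by (simp add: power2_eq_square algebra_simps)
        moreover have "0 \<le> c * (r * t)" using c r t by simp
        ultimately show ?thesis using tr by linarith
      qed
      finally have "exp (v * (- r)\<^sup>2 / (2 * (1 - c * - r))) \<le> exp (r * a - t)" by simp
      then show "expectation (\<lambda>\<omega>. exp (r * - X \<omega>)) \<le> exp (r * a - t)"
        using order_trans[OF mgf[OF l]] by simp
    qed (use r in auto)
    have "prob {\<omega> \<in> space M. a \<le> \<bar>X \<omega>\<bar>}
        \<le> prob ({\<omega> \<in> space M. a \<le> X \<omega>} \<union> {\<omega> \<in> space M. a \<le> - X \<omega>})"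
      by (rule finite_measure_mono) (auto simp: abs_real_def)
    also have "\<dots> \<le> prob {\<omega> \<in> space M. a \<le> X \<omega>} + prob {\<omega> \<in> space M. a \<le> - X \<omega>}"
      by (rule measure_Un_le) auto
    finally show ?thesis using upper lower by (simp add: a_def)
  qed
qed

end

section \<open>Projections along rays\<close>

lemma dist_scaleR_same: "0 \<le> t \<Longrightarrow> dist (t *\<^sub>R x) (t *\<^sub>R y) = t * dist x y"
  for x y :: "'a::real_normed_vector"
  by (simp add: dist_norm flip: scaleR_diff_right)

text \<open>The obtuse-angle inequalities of the two projections, weighted by \<open>t\<close> and
  \<open>s\<close>, eliminate \<open>x\<close>. Cauchy-Schwarz then yields
  \<open>(s * norm q - t * norm p) * (norm q - norm p) \<le> 0\<close>. If the first factor were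
  positive, \<open>s \<le> t\<close> would make the second positive too.\<close>

lemma projection_ratio_antimono:
  fixes K :: "'a::euclidean_space set"
  assumes K: "closed K" "convex K" "K \<noteq> {}" and st: "0 < s" "s \<le> t"
  shows "norm (closest_point K (a + t *\<^sub>R x) - a) / t \<le> norm (closest_point K (a + s *\<^sub>R x) - a) / s"
proof -
  define p where "p = closest_point K (a + s *\<^sub>R x) - a"
  define q where "q = closest_point K (a + t *\<^sub>R x) - a"
  have "(s *\<^sub>R x - p) \<bullet> (q - p) \<le> 0" "(t *\<^sub>R x - q) \<bullet> (p - q) \<le> 0"
    using closest_point_dot[OF K(2,1) closest_point_in_set[OF K(1,3)], of "a + s *\<^sub>R x" "a + t *\<^sub>R x"]
      closest_point_dot[OF K(2,1) closest_point_in_set[OF K(1,3)], of "a + t *\<^sub>R x" "a + s *\<^sub>R x"]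
    by (simp_all add: p_def q_def algebra_simps)
  then have 1: "s * (x \<bullet> (q - p)) \<le> p \<bullet> (q - p)" and 2: "q \<bullet> (q - p) \<le> t * (x \<bullet> (q - p))"
    by (simp_all add: inner_diff_left inner_diff_right right_diff_distrib inner_commute)
  have "s * (q \<bullet> (q - p)) \<le> s * (t * (x \<bullet> (q - p)))"
    using 2 st by (intro mult_left_mono) auto
  also have "\<dots> = t * (s * (x \<bullet> (q - p)))" by simp
  also have "\<dots> \<le> t * (p \<bullet> (q - p))" using 1 st by (intro mult_left_mono) auto
  finally have "s * (norm q)\<^sup>2 + t * (norm p)\<^sup>2 \<le> (s + t) * (p \<bullet> q)"
    by (simp add: power2_norm_eq_inner inner_diff_right inner_commute algebra_simps)
  also have "\<dots> \<le> (s + t) * (norm p * norm q)"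
    using st by (intro mult_left_mono norm_cauchy_schwarz) auto
  finally have "(s * norm q - t * norm p) * (norm q - norm p) \<le> 0"
    by (simp add: power2_eq_square algebra_simps)
  then have "s * norm q \<le> t * norm p"
  proof (rule contrapos_pp)
    assume "\<not> s * norm q \<le> t * norm p"
    then have gt: "t * norm p < s * norm q" by simp
    moreover have "s * norm q \<le> t * norm q" using st by (intro mult_right_mono) auto
    ultimately have "t * norm p < t * norm q" by simp
    then have "norm p < norm q" using st by simp
    with gt show "\<not> (s * norm q - t * norm p) * (norm q - norm p) \<le> 0"
      by (simp add: not_le)
  qed
  then show ?thesis using st by (simp add: p_def[symmetric] q_def[symmetric] field_simps)
qed

lemma tendsto_at_top_antimono:
  fixes r :: "real \<Rightarrow> real"
  assumes mono: "\<And>s t. 0 < s \<Longrightarrow> s \<le> t \<Longrightarrow> r t \<le> r s" and nonneg: "\<And>t. 0 < t \<Longrightarrow> 0 \<le> r t"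
  shows "\<exists>L. (r \<longlongrightarrow> L) at_top"
proof -
  define L where "L = (INF t\<in>{0<..}. r t)"
  have bdd: "bdd_below (r ` {0<..})" using nonneg by (intro bdd_belowI2[of _ 0]) auto
  have "(r \<longlongrightarrow> L) at_top"
  proof (rule order_tendstoI)
    fix a assume "a < L"
    have "L \<le> r t" if "0 < t" for t unfolding L_def using that bdd by (intro cINF_lower) auto
    with \<open>a < L\<close> show "\<forall>\<^sub>F t in at_top. a < r t"
      by (auto intro!: eventually_mono[OF eventually_gt_at_top[of "0 :: real"]] intro: less_le_trans)
  next
    fix a assume "L < a"
    then obtain s where s: "0 < s" "r s < a"
      unfolding L_def using cINF_less_iff[OF _ bdd, of a] by auto
    show "\<forall>\<^sub>F t in at_top. r t < a"
      using eventually_ge_at_top[of s]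
    proof eventually_elim
      case (elim t)
      with mono[OF s(1) elim] s(2) show ?case by simp
    qed
  qed
  then show ?thesis by blast
qed

text \<open>For nonempty closed convex \<open>K\<close> this is the norm of the projection of
  \<open>x\<close> onto the recession cone of \<open>K\<close>. As a limit it can be compared
  directly with the ratios at finite scale.\<close>

definition recession_ratio :: "'a::euclidean_space set \<Rightarrow> 'a \<Rightarrow> real" where
  "recession_ratio K x = Lim at_top (\<lambda>t. norm (closest_point K (t *\<^sub>R x)) / t)"

text \<open>Monotonicity gives the limit for base point 0. Nonexpansiveness changes the ratio by at
  most \<open>2 * norm a / t\<close> for any other base point, so the error and the statistical
  dimension share one limit.\<close>

lemma projection_ratio_tendsto:
  fixes K :: "'a::euclidean_space set"
  assumes K: "closed K" "convex K" "K \<noteq> {}"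
  shows "((\<lambda>t. norm (closest_point K (a + t *\<^sub>R x) - a) / t) \<longlongrightarrow> recession_ratio K x) at_top"
proof -
  define r where "r = (\<lambda>t. norm (closest_point K (t *\<^sub>R x)) / t)"
  have "\<exists>L. (r \<longlongrightarrow> L) at_top"
  proof (rule tendsto_at_top_antimono)
    show "r t \<le> r s" if "0 < s" "s \<le> t" for s t
      using projection_ratio_antimono[OF K that, of 0 x] by (simp add: r_def)
  qed (simp add: r_def)
  then obtain L where L: "(r \<longlongrightarrow> L) at_top" by blast
  moreover from this have "Lim at_top r = L" by (intro tendsto_Lim) simp
  ultimately have 0: "((\<lambda>t. norm (closest_point K (t *\<^sub>R x)) / t) \<longlongrightarrow> recession_ratio K x) at_top"
    by (simp add: recession_ratio_def r_def)
  have "((\<lambda>t. 2 * norm a / t) \<longlongrightarrow> 0) at_top"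
    by (rule real_tendsto_divide_at_top[OF tendsto_const filterlim_ident])
  then have "((\<lambda>t. norm (closest_point K (a + t *\<^sub>R x) - a) / t - norm (closest_point K (t *\<^sub>R x)) / t) \<longlongrightarrow> 0) at_top"
  proof (rule tendsto_0_le[where K = 1], intro eventually_mono[OF eventually_gt_at_top[of 0]])
    fix t :: real assume t: "0 < t"
    have "dist (closest_point K (a + t *\<^sub>R x)) (closest_point K (t *\<^sub>R x)) \<le> norm a"
      using closest_point_lipschitz[OF K(2,1,3), of "a + t *\<^sub>R x" "t *\<^sub>R x"] by (simp add: dist_norm)
    then have "\<bar>norm (closest_point K (a + t *\<^sub>R x) - a) - norm (closest_point K (t *\<^sub>R x))\<bar> \<le> 2 * norm a"
      using norm_triangle_ineq3[of "closest_point K (a + t *\<^sub>R x) - a" "closest_point K (t *\<^sub>R x)"]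
        norm_triangle_ineq4[of "closest_point K (a + t *\<^sub>R x) - closest_point K (t *\<^sub>R x)" a]
      by (simp add: dist_norm algebra_simps)
    then show "norm (norm (closest_point K (a + t *\<^sub>R x) - a) / t - norm (closest_point K (t *\<^sub>R x)) / t)
      \<le> norm (2 * norm a / t) * 1"
      using t by (simp add: diff_divide_distrib[symmetric] divide_right_mono)
  qed
  from tendsto_add[OF 0 this] show ?thesis by simp
qed

lemma recession_ratio_le:
  fixes K :: "'a::euclidean_space set"
  assumes K: "closed K" "convex K" "K \<noteq> {}" and t: "0 < t"
  shows "recession_ratio K x \<le> norm (closest_point K (a + t *\<^sub>R x) - a) / t"
proof (rule tendsto_upperbound[OF projection_ratio_tendsto[OF K]])
  show "\<forall>\<^sub>F s in at_top. norm (closest_point K (a + s *\<^sub>R x) - a) / s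
      \<le> norm (closest_point K (a + t *\<^sub>R x) - a) / t"
    using eventually_ge_at_top[of t] by eventually_elim (rule projection_ratio_antimono[OF K t])
qed simp

lemma recession_ratio_nonneg:
  assumes "closed K" "convex K" "K \<noteq> {}"
  shows "0 \<le> recession_ratio K x"
proof (rule tendsto_lowerbound[OF projection_ratio_tendsto[OF assms, of 0 x]])
  show "\<forall>\<^sub>F t in at_top. 0 \<le> norm (closest_point K (0 + t *\<^sub>R x) - 0) / t"
    using eventually_gt_at_top[of 0] by eventually_elim simp
qed simp

text \<open>The offset vanishes for \<open>a\<close> in \<open>K\<close>. It is kept for the
  statistical dimension, where \<open>a = 0\<close> may lie outside \<open>K\<close>.\<close>

lemma projection_ratio_le:
  fixes K :: "'a::euclidean_space set"
  assumes K: "closed K" "convex K" "K \<noteq> {}" and t: "0 < t"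
  shows "norm (closest_point K (a + t *\<^sub>R x) - a) / t \<le> norm (closest_point K a - a) / t + norm x"
proof -
  have "dist (closest_point K (a + t *\<^sub>R x)) (closest_point K a) \<le> norm (t *\<^sub>R x)"
    using closest_point_lipschitz[OF K(2,1,3), of "a + t *\<^sub>R x" a] by (simp add: dist_norm)
  then have "norm (closest_point K (a + t *\<^sub>R x) - a) \<le> norm (closest_point K a - a) + norm (t *\<^sub>R x)"
    using norm_triangle_ineq[of "closest_point K a - a" "closest_point K (a + t *\<^sub>R x) - closest_point K a"]
    unfolding dist_norm by simp
  then have "norm (closest_point K (a + t *\<^sub>R x) - a) \<le> norm (closest_point K a - a) + t * norm x"
    using t by simp
  then show ?thesis using t by (simp add: field_simps)
qed

section \<open>Tangent cones and the ratio at vanishing noise\<close>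

lemma tangent_cone_eq: "tangent_cone K a = closure (cone hull ((\<lambda>\<nu>. \<nu> - a) ` K))"
  unfolding tangent_cone_def cone_hull_expl by (rule arg_cong[of _ _ closure]) auto

lemma tangent_cone_properties:
  assumes K: "convex K" "a \<in> K"
  shows closed_tangent_cone: "closed (tangent_cone K a)"
    and convex_tangent_cone: "convex (tangent_cone K a)"
    and zero_in_tangent_cone: "0 \<in> tangent_cone K a"
    and scaleR_in_tangent_cone: "\<And>c x. 0 < c \<Longrightarrow> x \<in> tangent_cone K a \<Longrightarrow> c *\<^sub>R x \<in> tangent_cone K a"
    and diff_in_tangent_cone: "\<And>\<nu>. \<nu> \<in> K \<Longrightarrow> \<nu> - a \<in> tangent_cone K a"
proof -
  let ?C = "cone hull ((\<lambda>\<nu>. \<nu> - a) ` K)"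
  show "closed (tangent_cone K a)" by (simp add: tangent_cone_eq)
  have "convex ?C"
    using K by (intro convex_cone_hull) (simp add: convex_translation_subtract)
  then show "convex (tangent_cone K a)" unfolding tangent_cone_eq by (rule convex_closure)
  show d: "\<nu> - a \<in> tangent_cone K a" if "\<nu> \<in> K" for \<nu>
  proof -
    have "\<nu> - a \<in> ?C" using that by (intro hull_inc) auto
    then show ?thesis unfolding tangent_cone_eq using closure_subset by blast
  qed
  show "0 \<in> tangent_cone K a" using d[OF K(2)] by simp
  show "c *\<^sub>R x \<in> tangent_cone K a" if "0 < c" "x \<in> tangent_cone K a" for c x
  proof -
    have "(*\<^sub>R) c ` ?C \<subseteq> ?C"
      using mem_cone[OF cone_cone_hull] that(1) by fastforce
    then have "closure ((*\<^sub>R) c ` ?C) \<subseteq> closure ?C" by (rule closure_mono)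
    then show ?thesis
      using that(2) unfolding tangent_cone_eq closure_scaleR[symmetric] by blast
  qed
qed

text \<open>Rescaling by \<open>1 / t\<close> turns competitors for \<open>t *\<^sub>R x\<close>
  into competitors for \<open>x\<close>. On a cone the quotient defining the statistical dimension
  is therefore constant.\<close>

lemma closest_point_cone_scaleR:
  fixes T :: "'a::euclidean_space set"
  assumes T: "closed T" "convex T" "T \<noteq> {}"
    and cone: "\<And>c x. 0 < c \<Longrightarrow> x \<in> T \<Longrightarrow> c *\<^sub>R x \<in> T" and t: "0 < t"
  shows "closest_point T (t *\<^sub>R x) = t *\<^sub>R closest_point T x"
proof (rule closest_point_unique[OF T(2,1), symmetric])
  show "t *\<^sub>R closest_point T x \<in> T"
    using cone[OF t] closest_point_in_set[OF T(1,3)] by simp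
  show "\<forall>z\<in>T. dist (t *\<^sub>R x) (t *\<^sub>R closest_point T x) \<le> dist (t *\<^sub>R x) z"
  proof
    fix z assume "z \<in> T"
    then have "dist x (closest_point T x) \<le> dist x ((1 / t) *\<^sub>R z)"
      using t by (intro closest_point_le T cone) auto
    then have "t * dist x (closest_point T x) \<le> t * dist x ((1 / t) *\<^sub>R z)"
      using t by simp
    also have "\<dots> = dist (t *\<^sub>R x) (t *\<^sub>R ((1 / t) *\<^sub>R z))"
      using t by (subst dist_scaleR_same) simp_all
    finally show "dist (t *\<^sub>R x) (t *\<^sub>R closest_point T x) \<le> dist (t *\<^sub>R x) z"
      using t by (simp add: dist_scaleR_same)
  qed
qed

text \<open>The point \<open>q = (\<Pi>\<^sub>K (a + t x) - a) / t\<close> is the projection of \<open>x\<close> onto \<open>(K - a) / t\<close>, a subset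
  of the tangent cone containing any given direction into \<open>K\<close> once \<open>t\<close> is small; hence
  \<open>\<parallel>x - q\<parallel>\<close> tends to the distance from \<open>x\<close> to the cone, and obtuseness gives
  \<open>\<parallel>q - p\<parallel>\<^sup>2 \<le> \<parallel>x - q\<parallel>\<^sup>2 - \<parallel>x - p\<parallel>\<^sup>2\<close> for the projection \<open>p\<close> onto the cone.\<close>

lemma projection_ratio_tendsto_tangent_cone:
  fixes K :: "(real ^ 'n) set"
  assumes K: "closed K" "convex K" "a \<in> K"
  shows "((\<lambda>t. norm (closest_point K (a + t *\<^sub>R x) - a) / t)
    \<longlongrightarrow> norm (closest_point (tangent_cone K a) x)) (at_right 0)"
proof -
  define T where "T = tangent_cone K a"
  note T = tangent_cone_properties[OF K(2,3), folded T_def]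
  define p where "p = closest_point T x"
  define q where "q = (\<lambda>t. (1 / t) *\<^sub>R (closest_point K (a + t *\<^sub>R x) - a))"
  have Kne: "K \<noteq> {}" and Tne: "T \<noteq> {}" using K T by auto
  have qT: "q t \<in> T" if "0 < t" for t
    unfolding q_def using that closest_point_in_set[OF K(1) Kne] by (intro T(4,5)) auto
  have "(q \<longlongrightarrow> p) (at_right 0)"
  proof (rule tendstoI)
    fix e :: real assume e: "e > 0"
    define D where "D = norm (x - p)"
    \<comment> \<open>Small enough for \<open>(D + d)^2 - D^2 = d * (2 * D + d)\<close> to stay
      below \<open>e^2\<close>; the bound \<open>d \<le> 1\<close> makes the comparison with
      \<open>2 * D + 2\<close> strict.\<close>
    define d where "d = min 1 (e\<^sup>2 / (2 * D + 2))"
    have D: "D \<ge> 0" by (simp add: D_def)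
    have d: "0 < d" "d \<le> 1" "d * (2 * D + 2) \<le> e\<^sup>2"
    proof -
      have "d \<le> e\<^sup>2 / (2 * D + 2)" by (simp add: d_def)
      then show "d * (2 * D + 2) \<le> e\<^sup>2" using D by (simp add: field_simps)
    qed (use e D in \<open>auto simp: d_def\<close>)
    have "p \<in> T" unfolding p_def by (rule closest_point_in_set[OF T(1) Tne])
    then obtain y where y: "y \<in> {\<alpha> *\<^sub>R (\<nu> - a) | \<alpha> \<nu>. \<alpha> \<ge> 0 \<and> \<nu> \<in> K}" "dist y p < d"
      unfolding T_def tangent_cone_def closure_approachable using d(1) by blast
    then obtain \<alpha> \<nu> where \<nu>: "\<alpha> \<ge> 0" "\<nu> \<in> K" "y = \<alpha> *\<^sub>R (\<nu> - a)" by blast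
    \<comment> \<open>For such \<open>t\<close>, \<open>t * \<alpha> \<le> 1\<close> makes
      \<open>a + t *\<^sub>R y\<close> a convex combination of \<open>a\<close> and
      \<open>\<nu>\<close>, hence a competitor in \<open>K\<close>. The \<open>+ 1\<close> covers
      \<open>\<alpha> = 0\<close>.\<close>
    have close: "dist (q t) p < e" if t: "0 < t" "t < 1 / (\<alpha> + 1)" for t
    proof -
      have "t * \<alpha> \<le> 1"
      proof -
        have "t * (\<alpha> + 1) < 1" using t \<nu>(1) by (simp add: field_simps)
        then show ?thesis using t by (simp add: distrib_left)
      qed
      then have "(1 - t * \<alpha>) *\<^sub>R a + (t * \<alpha>) *\<^sub>R \<nu> \<in> K"
        using K \<nu> t by (intro convexD) auto
      then have "a + t *\<^sub>R y \<in> K" by (simp add: \<nu>(3) algebra_simps)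
      then have "dist (a + t *\<^sub>R x) (closest_point K (a + t *\<^sub>R x)) \<le> dist (a + t *\<^sub>R x) (a + t *\<^sub>R y)"
        by (rule closest_point_le[OF K(1)])
      moreover have "closest_point K (a + t *\<^sub>R x) = a + t *\<^sub>R q t" using t by (simp add: q_def)
      ultimately have "t * norm (x - q t) \<le> t * norm (x - y)"
        using t by (simp add: dist_scaleR_same) (simp add: dist_norm)
      then have "norm (x - q t) \<le> norm (x - y)" using t by simp
      also have "\<dots> \<le> D + d"
        using y(2) norm_triangle_ineq[of "x - p" "p - y"] by (simp add: D_def dist_norm norm_minus_commute)
      finally have "(norm (x - q t))\<^sup>2 \<le> (D + d)\<^sup>2" by (intro power_mono) auto
      moreover have "(x - p) \<bullet> (q t - p) \<le> 0"
        unfolding p_def by (rule closest_point_dot[OF T(2,1) qT[OF t(1)]])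
      then have "(norm (q t - p))\<^sup>2 \<le> (norm (x - q t))\<^sup>2 - D\<^sup>2"
        unfolding D_def power2_norm_eq_inner
        by (simp add: inner_diff_left inner_diff_right inner_commute)
      ultimately have "(norm (q t - p))\<^sup>2 \<le> (D + d)\<^sup>2 - D\<^sup>2" by linarith
      also have "\<dots> = d * (2 * D + d)" by (simp add: power2_eq_square algebra_simps)
      also have "\<dots> < d * (2 * D + 2)" using d by simp
      also have "\<dots> \<le> e\<^sup>2" by (rule d(3))
      finally show ?thesis using e by (simp add: dist_norm power_less_imp_less_base)
    qed
    have "\<forall>\<^sub>F t in at_right 0. t \<in> {0<..<1 / (\<alpha> + 1)}"
      using \<nu>(1) by (intro eventually_at_right_real) simp
    then show "\<forall>\<^sub>F t in at_right 0. dist (q t) p < e"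
      by eventually_elim (use close in auto)
  qed
  then have "((\<lambda>t. norm (q t)) \<longlongrightarrow> norm p) (at_right 0)" by (rule tendsto_norm)
  moreover have "\<forall>\<^sub>F t in at_right 0. norm (q t) = norm (closest_point K (a + t *\<^sub>R x) - a) / t"
    unfolding eventually_at_right_field by (intro exI[of _ 1]) (auto simp: q_def)
  ultimately show ?thesis
    unfolding p_def T_def by (rule Lim_transform_eventually)
qed

section \<open>Projections of a Gaussian vector\<close>

lemma projection_error_square_le:
  fixes K :: "'a::euclidean_space set"
  assumes K: "closed K" "convex K" "K \<noteq> {}" and t: "0 < t"
  shows "(norm (closest_point K (a + t *\<^sub>R x) - a))\<^sup>2 / t\<^sup>2
    \<le> 2 * (norm (closest_point K a - a) / t)\<^sup>2 + 2 * (norm x)\<^sup>2"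
proof -
  have "(norm (closest_point K (a + t *\<^sub>R x) - a) / t)\<^sup>2 \<le> (norm (closest_point K a - a) / t + norm x)\<^sup>2"
    using projection_ratio_le[OF K t] t by (intro power_mono) auto
  also have "\<dots> \<le> 2 * (norm (closest_point K a - a) / t)\<^sup>2 + 2 * (norm x)\<^sup>2"
    using square_le_weighted[of 1] by simp
  finally show ?thesis by (simp add: power_divide)
qed

context
  fixes M :: "'w measure" and h :: "'w \<Rightarrow> real ^ 'n"
  assumes M: "prob_space M" and h: "std_gaussian_vector M h"
begin

interpretation prob_space M by (rule M)

lemma projection_error_measurable:
  assumes "closed K" "convex K" "K \<noteq> {}"
  shows "(\<lambda>\<omega>. norm (closest_point K (a + t *\<^sub>R h \<omega>) - a)) \<in> borel_measurable M"
proof -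
  have [measurable]: "h \<in> borel_measurable M" by (rule std_gaussian_vector_measurable[OF h])
  have [measurable]: "closest_point K \<in> borel_measurable borel"
    using assms by (intro borel_measurable_continuous_onI continuous_on_closest_point)
  show ?thesis by measurable
qed

lemma integrable_projection_error:
  assumes K: "closed K" "convex K" "K \<noteq> {}" and t: "0 < t"
  shows "integrable M (\<lambda>\<omega>. (norm (closest_point K (a + t *\<^sub>R h \<omega>) - a))\<^sup>2)"
proof -
  note [measurable] = projection_error_measurable[OF K]
  define C where "C = 2 * (norm (closest_point K a - a) / t)\<^sup>2"
  have "integrable M (\<lambda>\<omega>. t\<^sup>2 * (C + 2 * (norm (h \<omega>))\<^sup>2))"
    by (intro integrable_mult_right Bochner_Integration.integrable_add
        integrable_norm_std_gaussian_vector[OF h]) simp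
  then show ?thesis
  proof (rule Bochner_Integration.integrable_bound)
    show "AE \<omega> in M. norm ((norm (closest_point K (a + t *\<^sub>R h \<omega>) - a))\<^sup>2)
      \<le> norm (t\<^sup>2 * (C + 2 * (norm (h \<omega>))\<^sup>2))"
    proof (rule AE_I2)
      fix \<omega>
      have "(norm (closest_point K (a + t *\<^sub>R h \<omega>) - a))\<^sup>2 \<le> t\<^sup>2 * (C + 2 * (norm (h \<omega>))\<^sup>2)"
        using projection_error_square_le[OF K t, of a "h \<omega>"] t by (simp add: C_def pos_divide_le_eq mult.commute)
      then show "norm ((norm (closest_point K (a + t *\<^sub>R h \<omega>) - a))\<^sup>2)
        \<le> norm (t\<^sup>2 * (C + 2 * (norm (h \<omega>))\<^sup>2))" by (simp add: abs_of_nonneg)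
    qed
  qed measurable
qed

lemma expected_projection_error_tendsto:
  assumes K: "closed K" "convex K" "K \<noteq> {}"
  shows "integrable M (\<lambda>\<omega>. (recession_ratio K (h \<omega>))\<^sup>2)"
    and "((\<lambda>t. (\<integral>\<omega>. (norm (closest_point K (a + t *\<^sub>R h \<omega>) - a))\<^sup>2 \<partial>M) / t\<^sup>2)
      \<longlongrightarrow> (\<integral>\<omega>. (recession_ratio K (h \<omega>))\<^sup>2 \<partial>M)) at_top"
proof -
  note [measurable] = projection_error_measurable[OF K]
  define s where "s = (\<lambda>a t \<omega>. (norm (closest_point K (a + t *\<^sub>R h \<omega>) - a))\<^sup>2 / t\<^sup>2)"
  \<comment> \<open>A majorant for all \<open>t \<ge> 1\<close>, where dividing the offset by
    \<open>t\<close> only decreases it.\<close>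
  define w where "w = (\<lambda>a \<omega>. 2 * (norm (closest_point K a - a))\<^sup>2 + 2 * (norm (h \<omega>))\<^sup>2)"
  have lim: "((\<lambda>t. s a t \<omega>) \<longlongrightarrow> (recession_ratio K (h \<omega>))\<^sup>2) at_top" for a \<omega>
    using tendsto_power[OF projection_ratio_tendsto[OF K, of a "h \<omega>"], of 2]
    by (simp add: s_def power_divide)
  have sm[measurable]: "s a t \<in> borel_measurable M" for a t
    unfolding s_def by measurable
  \<comment> \<open>Measurability of the limit comes from the sequence of integer scales.\<close>
  have m: "(\<lambda>\<omega>. (recession_ratio K (h \<omega>))\<^sup>2) \<in> borel_measurable M"
    by (rule borel_measurable_LIMSEQ_real[where u = "\<lambda>n. s 0 (real n)"])
       (auto intro: filterlim_compose[OF lim filterlim_real_sequentially])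
  have w: "integrable M (w a)" for a
    unfolding w_def
    by (intro Bochner_Integration.integrable_add integrable_mult_right
        integrable_norm_std_gaussian_vector[OF h]) simp
  have bound: "\<forall>\<^sub>F t in at_top. AE \<omega> in M. norm (s a t \<omega>) \<le> w a \<omega>" for a
    using eventually_ge_at_top[of 1]
  proof eventually_elim
    case (elim t)
    show ?case
    proof (rule AE_I2)
      fix \<omega>
      have "norm (closest_point K a - a) / t \<le> norm (closest_point K a - a)"
        using elim by (simp add: divide_le_eq mult_left_mono[of 1 t, simplified])
      then have "(norm (closest_point K a - a) / t)\<^sup>2 \<le> (norm (closest_point K a - a))\<^sup>2"
        using elim by (intro power_mono) auto
      moreover have "s a t \<omega> \<le> 2 * (norm (closest_point K a - a) / t)\<^sup>2 + 2 * (norm (h \<omega>))\<^sup>2"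
        unfolding s_def using elim by (intro projection_error_square_le[OF K]) auto
      ultimately have "s a t \<omega> \<le> w a \<omega>" unfolding w_def by linarith
      then show "norm (s a t \<omega>) \<le> w a \<omega>" by (simp add: s_def)
    qed
  qed
  show "integrable M (\<lambda>\<omega>. (recession_ratio K (h \<omega>))\<^sup>2)"
    by (rule integrable_dominated_convergence_at_top[OF m sm w[of 0] _ bound])
       (use lim in auto)
  have "((\<lambda>t. integral\<^sup>L M (s a t)) \<longlongrightarrow> (\<integral>\<omega>. (recession_ratio K (h \<omega>))\<^sup>2 \<partial>M)) at_top"
    by (rule integral_dominated_convergence_at_top[OF m sm w _ bound])
       (use lim in auto)
  then show "((\<lambda>t. (\<integral>\<omega>. (norm (closest_point K (a + t *\<^sub>R h \<omega>) - a))\<^sup>2 \<partial>M) / t\<^sup>2)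
      \<longlongrightarrow> (\<integral>\<omega>. (recession_ratio K (h \<omega>))\<^sup>2 \<partial>M)) at_top"
    by (simp add: s_def)
qed

lemma stat_dim_eq:
  assumes K: "closed K" "convex K" "K \<noteq> {}"
  shows "stat_dim M h K = (\<integral>\<omega>. (recession_ratio K (h \<omega>))\<^sup>2 \<partial>M)"
  unfolding stat_dim_def
  using expected_projection_error_tendsto(2)[OF K, of 0] by (intro tendsto_Lim) auto

lemma stat_dim_cone:
  assumes T: "closed T" "convex T" "T \<noteq> {}"
    and cone: "\<And>c x. 0 < c \<Longrightarrow> x \<in> T \<Longrightarrow> c *\<^sub>R x \<in> T"
  shows "stat_dim M h T = (\<integral>\<omega>. (norm (closest_point T (h \<omega>)))\<^sup>2 \<partial>M)"
  unfolding stat_dim_def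
proof (rule tendsto_Lim)
  show "((\<lambda>t. (\<integral>\<omega>. (norm (closest_point T (t *\<^sub>R h \<omega>)))\<^sup>2 \<partial>M) / t\<^sup>2)
      \<longlongrightarrow> (\<integral>\<omega>. (norm (closest_point T (h \<omega>)))\<^sup>2 \<partial>M)) at_top"
  proof (rule tendsto_eventually, rule eventually_mono[OF eventually_gt_at_top[of 0]])
    fix t :: real assume t: "0 < t"
    then show "(\<integral>\<omega>. (norm (closest_point T (t *\<^sub>R h \<omega>)))\<^sup>2 \<partial>M) / t\<^sup>2
      = (\<integral>\<omega>. (norm (closest_point T (h \<omega>)))\<^sup>2 \<partial>M)"
      by (simp add: closest_point_cone_scaleR[OF T cone] power_mult_distrib)
  qed
qed simp

lemma expected_projection_error_tendsto_tangent_cone: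
  assumes K: "closed K" "convex K" "a \<in> K"
  shows "((\<lambda>t. (\<integral>\<omega>. (norm (closest_point K (a + t *\<^sub>R h \<omega>) - a))\<^sup>2 \<partial>M) / t\<^sup>2)
    \<longlongrightarrow> stat_dim M h (tangent_cone K a)) (at_right 0)"
proof -
  have Kne: "K \<noteq> {}" using K by auto
  note T = tangent_cone_properties[OF K(2,3)]
  have Tne: "tangent_cone K a \<noteq> {}" using T(3) by auto
  note [measurable] = projection_error_measurable[OF K(1,2) Kne]
  define s where "s = (\<lambda>t \<omega>. (norm (closest_point K (a + t *\<^sub>R h \<omega>) - a))\<^sup>2 / t\<^sup>2)"
  have lim: "((\<lambda>t. s t \<omega>) \<longlongrightarrow> (norm (closest_point (tangent_cone K a) (h \<omega>)))\<^sup>2) (at_right 0)" for \<omega>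
    using tendsto_power[OF projection_ratio_tendsto_tangent_cone[OF K, of "h \<omega>"], of 2]
    by (simp add: s_def power_divide)
  \<comment> \<open>Inverting \<open>t\<close> turns the limit at 0 into one at infinity, the form
    in which dominated convergence is applied. With \<open>a\<close> in \<open>K\<close> the offset
    is zero, so the majorant is independent of \<open>t\<close>.\<close>
  have "((\<lambda>t. integral\<^sup>L M (s (inverse t)))
      \<longlongrightarrow> (\<integral>\<omega>. (norm (closest_point (tangent_cone K a) (h \<omega>)))\<^sup>2 \<partial>M)) at_top"
  proof (rule integral_dominated_convergence_at_top)
    show "(\<lambda>\<omega>. (norm (closest_point (tangent_cone K a) (h \<omega>)))\<^sup>2) \<in> borel_measurable M"
      using projection_error_measurable[OF T(1,2) Tne, of 0 1] by simp
    show "s (inverse t) \<in> borel_measurable M" for t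
      unfolding s_def by measurable
    show "integrable M (\<lambda>\<omega>. 2 * (norm (h \<omega>))\<^sup>2)"
      by (intro integrable_mult_right integrable_norm_std_gaussian_vector[OF h])
    show "AE \<omega> in M. ((\<lambda>t. s (inverse t) \<omega>) \<longlongrightarrow> (norm (closest_point (tangent_cone K a) (h \<omega>)))\<^sup>2) at_top"
      using lim by (intro AE_I2) (simp add: filterlim_at_right_to_top)
    show "\<forall>\<^sub>F t in at_top. AE \<omega> in M. norm (s (inverse t) \<omega>) \<le> 2 * (norm (h \<omega>))\<^sup>2"
      using eventually_gt_at_top[of 0]
    proof eventually_elim
      case (elim t)
      then show ?case
        using projection_error_square_le[OF K(1,2) Kne, of "inverse t" a]
        by (intro AE_I2) (simp add: s_def closest_point_self[OF K(3)])
    qed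
  qed
  then have "((\<lambda>t. integral\<^sup>L M (s t))
      \<longlongrightarrow> (\<integral>\<omega>. (norm (closest_point (tangent_cone K a) (h \<omega>)))\<^sup>2 \<partial>M)) (at_right 0)"
    by (simp add: filterlim_at_right_to_top)
  then show ?thesis
    using stat_dim_cone[OF T(1,2) Tne T(4)] by (simp add: s_def)
qed

text \<open>The Lipschitz bound at \<open>l * \<sigma>^2\<close> controls the uncentred moment, and
  its finiteness gives integrability. Centring subtracts \<open>l * m\<close>; the factor
  \<open>l^2\<close> comes from \<open>l / (1 - 2 * \<sigma>^2 * l) - l = 2 * \<sigma>^2 * l^2 / (1
  - 2 * \<sigma>^2 * l)\<close>.\<close>

lemma err_mgf:
  fixes K :: "(real ^ 'n) set"
  assumes K: "closed K" "convex K" "a \<in> K" and \<sigma>: "\<sigma> > 0" and l: "l < 1 / (2 * \<sigma>\<^sup>2)"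
  defines "m \<equiv> \<integral>\<omega>. err K a \<sigma> (h \<omega>) \<partial>M"
  shows "integrable M (\<lambda>\<omega>. exp (l * (err K a \<sigma> (h \<omega>) - m)))"
    and "(\<integral>\<omega>. exp (l * (err K a \<sigma> (h \<omega>) - m)) \<partial>M) \<le> exp (2 * \<sigma>\<^sup>2 * l\<^sup>2 * m / (1 - 2 * \<sigma>\<^sup>2 * l))"
proof -
  have Kne: "K \<noteq> {}" using K by auto
  note [measurable] = projection_error_measurable[OF K(1,2) Kne]
  have [measurable]: "(\<lambda>\<omega>. err K a \<sigma> (h \<omega>)) \<in> borel_measurable M"
    unfolding err_def by measurable
  define g where "g = (\<lambda>x. norm (closest_point K (a + \<sigma> *\<^sub>R x) - a) / \<sigma>)"
  have err_g: "err K a \<sigma> x = \<sigma>\<^sup>2 * (g x)\<^sup>2" for x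
    using \<sigma> by (simp add: err_def g_def power_divide)
  have g: "\<bar>g x - g y\<bar> \<le> norm (x - y)" for x y
  proof -
    have "\<bar>norm (closest_point K (a + \<sigma> *\<^sub>R x) - a) - norm (closest_point K (a + \<sigma> *\<^sub>R y) - a)\<bar>
        \<le> dist (closest_point K (a + \<sigma> *\<^sub>R x)) (closest_point K (a + \<sigma> *\<^sub>R y))"
      using norm_triangle_ineq3[of "closest_point K (a + \<sigma> *\<^sub>R x) - a" "closest_point K (a + \<sigma> *\<^sub>R y) - a"]
      by (simp add: dist_norm)
    also have "\<dots> \<le> dist (a + \<sigma> *\<^sub>R x) (a + \<sigma> *\<^sub>R y)"
      by (rule closest_point_lipschitz[OF K(2,1) Kne])
    also have "\<dots> = \<sigma> * norm (x - y)"
      using \<sigma> by (simp add: dist_scaleR_same) (simp add: dist_norm)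
    finally show ?thesis
      using \<sigma> by (simp add: g_def diff_divide_distrib[symmetric] divide_le_eq mult.commute)
  qed
  define l' where "l' = l * \<sigma>\<^sup>2"
  have l': "l' < 1 / 2" using l \<sigma> by (simp add: l'_def field_simps)
  have le: "l' * (g x)\<^sup>2 = l * err K a \<sigma> x" for x by (simp add: l'_def err_g)
  have m: "m = \<sigma>\<^sup>2 * (\<integral>\<omega>. (g (h \<omega>))\<^sup>2 \<partial>M)" by (simp add: m_def err_g)
  have e: "l' / (1 - 2 * l') * (\<integral>\<omega>. (g (h \<omega>))\<^sup>2 \<partial>M) = l * m / (1 - 2 * \<sigma>\<^sup>2 * l)"
    by (simp add: m l'_def mult_ac)
  have nn: "(\<integral>\<^sup>+\<omega>. ennreal (exp (l * err K a \<sigma> (h \<omega>))) \<partial>M) \<le> ennreal (exp (l * m / (1 - 2 * \<sigma>\<^sup>2 * l)))"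
    using gaussian_lipschitz_square_mgf[OF h g l'] unfolding le e .
  have i: "integrable M (\<lambda>\<omega>. exp (l * err K a \<sigma> (h \<omega>)))"
    using nn by (intro integrableI_nonneg) (auto simp: less_top[symmetric] top_unique)
  have "ennreal (\<integral>\<omega>. exp (l * err K a \<sigma> (h \<omega>)) \<partial>M) \<le> ennreal (exp (l * m / (1 - 2 * \<sigma>\<^sup>2 * l)))"
    using nn i by (subst nn_integral_eq_integral[symmetric]) auto
  then have b: "(\<integral>\<omega>. exp (l * err K a \<sigma> (h \<omega>)) \<partial>M) \<le> exp (l * m / (1 - 2 * \<sigma>\<^sup>2 * l))" by simp
  have split: "exp (l * (err K a \<sigma> x - m)) = exp (- (l * m)) * exp (l * err K a \<sigma> x)" for x
    by (simp add: right_diff_distrib flip: exp_add)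
  show "integrable M (\<lambda>\<omega>. exp (l * (err K a \<sigma> (h \<omega>) - m)))"
    unfolding split by (rule integrable_mult_right[OF i])
  have "(\<integral>\<omega>. exp (l * (err K a \<sigma> (h \<omega>) - m)) \<partial>M) = exp (- (l * m)) * (\<integral>\<omega>. exp (l * err K a \<sigma> (h \<omega>)) \<partial>M)"
    unfolding split by simp
  also have "\<dots> \<le> exp (- (l * m)) * exp (l * m / (1 - 2 * \<sigma>\<^sup>2 * l))"
    using b by (intro mult_left_mono) auto
  also have "\<dots> = exp (l * m / (1 - 2 * \<sigma>\<^sup>2 * l) - l * m)" by (simp flip: exp_add)
  also have "l * m / (1 - 2 * \<sigma>\<^sup>2 * l) - l * m = 2 * \<sigma>\<^sup>2 * l\<^sup>2 * m / (1 - 2 * \<sigma>\<^sup>2 * l)"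
  proof -
    have "1 - 2 * \<sigma>\<^sup>2 * l \<noteq> 0" using l' by (simp add: l'_def mult_ac)
    then show ?thesis by (simp add: divide_simps) (simp add: power2_eq_square algebra_simps)
  qed
  finally show "(\<integral>\<omega>. exp (l * (err K a \<sigma> (h \<omega>) - m)) \<partial>M) \<le> exp (2 * \<sigma>\<^sup>2 * l\<^sup>2 * m / (1 - 2 * \<sigma>\<^sup>2 * l))" .
qed

end

theorem proposition4p3:
  fixes M :: "'w measure"
    and h :: "'w \<Rightarrow> real ^ 'n"
    and K :: "(real ^ 'n) set"
    and \<mu>0 :: "real ^ 'n"
  assumes "prob_space M"
    and "std_gaussian_vector M h"
    and "closed K" and "convex K" and "\<mu>0 \<in> K"
  shows
    "(\<forall>\<sigma>>0. integrable M (\<lambda>\<omega>. err K \<mu>0 \<sigma> (h \<omega>)) \<and> integrable M (\<lambda>\<omega>. (err K \<mu>0 \<sigma> (h \<omega>))\<^sup>2)) \<and>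
     (\<forall>C\<in>{K, tangent_cone K \<mu>0}.
        (\<forall>\<tau>>0. integrable M (\<lambda>\<omega>. (norm (closest_point C (\<tau> *\<^sub>R h \<omega>)))\<^sup>2)) \<and>
        ((\<lambda>\<tau>. (\<integral>\<omega>. (norm (closest_point C (\<tau> *\<^sub>R h \<omega>)))\<^sup>2 \<partial>M) / \<tau>\<^sup>2) \<longlongrightarrow> stat_dim M h C) at_top) \<and>
     (\<forall>\<omega>\<in>space M. \<exists>L.
        ((\<lambda>\<tau>. (norm (closest_point K (\<tau> *\<^sub>R h \<omega>)))\<^sup>2 / \<tau>\<^sup>2) \<longlongrightarrow> L) at_top \<and>
        (\<forall>\<sigma>>0. L \<le> err K \<mu>0 \<sigma> (h \<omega>) / \<sigma>\<^sup>2 \<and> err K \<mu>0 \<sigma> (h \<omega>) / \<sigma>\<^sup>2 \<le> (norm (h \<omega>))\<^sup>2) \<and>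
        ((\<lambda>\<sigma>. err K \<mu>0 \<sigma> (h \<omega>) / \<sigma>\<^sup>2) \<longlongrightarrow> L) at_top) \<and>
     (((\<lambda>\<sigma>. (\<integral>\<omega>. err K \<mu>0 \<sigma> (h \<omega>) \<partial>M) / \<sigma>\<^sup>2) \<longlongrightarrow> stat_dim M h K) at_top) \<and>
     (((\<lambda>\<sigma>. (\<integral>\<omega>. err K \<mu>0 \<sigma> (h \<omega>) \<partial>M) / \<sigma>\<^sup>2) \<longlongrightarrow> stat_dim M h (tangent_cone K \<mu>0)) (at_right 0)) \<and>
     (stat_dim M h K \<le> stat_dim M h (tangent_cone K \<mu>0)) \<and>
     (\<forall>\<sigma>>0. prob_space.variance M (\<lambda>\<omega>. err K \<mu>0 \<sigma> (h \<omega>)) \<le> 4 * \<sigma>\<^sup>2 * (\<integral>\<omega>. err K \<mu>0 \<sigma> (h \<omega>) \<partial>M)) \<and>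
     (\<forall>\<sigma>>0. \<forall>l < 1 / (2 * \<sigma>\<^sup>2).
        integrable M (\<lambda>\<omega>. exp (l * (err K \<mu>0 \<sigma> (h \<omega>) - (\<integral>\<omega>'. err K \<mu>0 \<sigma> (h \<omega>') \<partial>M)))) \<and>
        (\<integral>\<omega>. exp (l * (err K \<mu>0 \<sigma> (h \<omega>) - (\<integral>\<omega>'. err K \<mu>0 \<sigma> (h \<omega>') \<partial>M))) \<partial>M)
          \<le> exp (2 * \<sigma>\<^sup>2 * l\<^sup>2 * (\<integral>\<omega>. err K \<mu>0 \<sigma> (h \<omega>) \<partial>M) / (1 - 2 * \<sigma>\<^sup>2 * l))) \<and>
     (\<forall>\<sigma>>0. \<forall>t\<ge>0.
        measure M {\<omega> \<in> space M.
            \<bar>err K \<mu>0 \<sigma> (h \<omega>) - (\<integral>\<omega>'. err K \<mu>0 \<sigma> (h \<omega>') \<partial>M)\<bar>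
              \<ge> sqrt (8 * \<sigma>\<^sup>2 * (\<integral>\<omega>'. err K \<mu>0 \<sigma> (h \<omega>') \<partial>M) * t) + 2 * \<sigma>\<^sup>2 * t}
          \<le> 2 * exp (- t))"
proof -
  interpret prob_space M by fact
  note K = \<open>closed K\<close> \<open>convex K\<close> and \<mu>0 = \<open>\<mu>0 \<in> K\<close>
  have Kne: "K \<noteq> {}" using \<mu>0 by auto
  note law = assms(1,2)
  note T = tangent_cone_properties[OF K(2) \<mu>0]
  have Tne: "tangent_cone K \<mu>0 \<noteq> {}" using T(3) by auto
  define m where "m = (\<lambda>\<sigma>. \<integral>\<omega>. err K \<mu>0 \<sigma> (h \<omega>) \<partial>M)"
  have int: "integrable M (\<lambda>\<omega>. err K \<mu>0 \<sigma> (h \<omega>))" if "\<sigma> > 0" for \<sigma>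
    unfolding err_def by (rule integrable_projection_error[OF law K Kne that])
  have m: "0 \<le> m \<sigma>" for \<sigma>
    unfolding m_def err_def by simp
  have mgf: "integrable M (\<lambda>\<omega>. exp (l * (err K \<mu>0 \<sigma> (h \<omega>) - m \<sigma>)))"
    "(\<integral>\<omega>. exp (l * (err K \<mu>0 \<sigma> (h \<omega>) - m \<sigma>)) \<partial>M) \<le> exp (2 * \<sigma>\<^sup>2 * l\<^sup>2 * m \<sigma> / (1 - 2 * \<sigma>\<^sup>2 * l))"
    if "\<sigma> > 0" "l < 1 / (2 * \<sigma>\<^sup>2)" for \<sigma> l
    unfolding m_def by (rule err_mgf[OF law K \<mu>0 that])+
  \<comment> \<open>The sub-gamma parameters are \<open>v = 4 * \<sigma>^2 * m \<sigma>\<close> and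
    \<open>c = 2 * \<sigma>^2\<close>. Then \<open>v\<close> is the variance bound and
    \<open>sqrt (2 * v * t) + c * t\<close> the deviation threshold.\<close>
  have sub_gamma:
    "0 < 2 * \<sigma>\<^sup>2" "0 \<le> 4 * \<sigma>\<^sup>2 * m \<sigma>"
    "(\<lambda>\<omega>. err K \<mu>0 \<sigma> (h \<omega>) - m \<sigma>) \<in> borel_measurable M"
    "\<And>l. l < 1 / (2 * \<sigma>\<^sup>2) \<Longrightarrow> expectation (\<lambda>\<omega>. exp (l * (err K \<mu>0 \<sigma> (h \<omega>) - m \<sigma>)))
      \<le> exp (4 * \<sigma>\<^sup>2 * m \<sigma> * l\<^sup>2 / (2 * (1 - 2 * \<sigma>\<^sup>2 * l)))" if \<sigma>: "\<sigma> > 0" for \<sigma>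
  proof -
    show "0 < 2 * \<sigma>\<^sup>2" "0 \<le> 4 * \<sigma>\<^sup>2 * m \<sigma>" using \<sigma> m by simp_all
    show "(\<lambda>\<omega>. err K \<mu>0 \<sigma> (h \<omega>) - m \<sigma>) \<in> borel_measurable M"
      using int[OF \<sigma>] by measurable
    fix l assume l: "l < 1 / (2 * \<sigma>\<^sup>2)"
    have "4 * \<sigma>\<^sup>2 * m \<sigma> * l\<^sup>2 / (2 * (1 - 2 * \<sigma>\<^sup>2 * l)) = 2 * (2 * \<sigma>\<^sup>2 * l\<^sup>2 * m \<sigma>) / (2 * (1 - 2 * \<sigma>\<^sup>2 * l))"
      by (simp add: mult_ac)
    also have "\<dots> = 2 * \<sigma>\<^sup>2 * l\<^sup>2 * m \<sigma> / (1 - 2 * \<sigma>\<^sup>2 * l)"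
      by (rule mult_divide_mult_cancel_left) simp
    finally show "expectation (\<lambda>\<omega>. exp (l * (err K \<mu>0 \<sigma> (h \<omega>) - m \<sigma>)))
        \<le> exp (4 * \<sigma>\<^sup>2 * m \<sigma> * l\<^sup>2 / (2 * (1 - 2 * \<sigma>\<^sup>2 * l)))"
      using mgf(2)[OF \<sigma> l] by simp
  qed
  have var: "integrable M (\<lambda>\<omega>. (err K \<mu>0 \<sigma> (h \<omega>) - m \<sigma>)\<^sup>2)"
    "expectation (\<lambda>\<omega>. (err K \<mu>0 \<sigma> (h \<omega>) - m \<sigma>)\<^sup>2) \<le> 4 * \<sigma>\<^sup>2 * m \<sigma>" if \<sigma>: "\<sigma> > 0" for \<sigma>
    using sub_gamma_second_moment[OF sub_gamma(3)[OF \<sigma>] sub_gamma(1)[OF \<sigma>] sub_gamma(2)[OF \<sigma>] mgf(1)[OF \<sigma>] sub_gamma(4)[OF \<sigma>]]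
    by simp_all
  have int2: "integrable M (\<lambda>\<omega>. (err K \<mu>0 \<sigma> (h \<omega>))\<^sup>2)" if \<sigma>: "\<sigma> > 0" for \<sigma>
  proof -
    have "integrable M (\<lambda>\<omega>. (err K \<mu>0 \<sigma> (h \<omega>) - m \<sigma>)\<^sup>2 + 2 * m \<sigma> * err K \<mu>0 \<sigma> (h \<omega>) - (m \<sigma>)\<^sup>2)"
      using var(1)[OF \<sigma>] int[OF \<sigma>] by simp
    then show ?thesis by (simp add: power2_diff algebra_simps)
  qed
  have tail: "measure M {\<omega> \<in> space M. \<bar>err K \<mu>0 \<sigma> (h \<omega>) - m \<sigma>\<bar> \<ge> sqrt (8 * \<sigma>\<^sup>2 * m \<sigma> * t) + 2 * \<sigma>\<^sup>2 * t}
      \<le> 2 * exp (- t)" if \<sigma>: "\<sigma> > 0" and t: "t \<ge> 0" for \<sigma> t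
    using sub_gamma_tail[OF sub_gamma(3)[OF \<sigma>] sub_gamma(1)[OF \<sigma>] sub_gamma(2)[OF \<sigma>] t mgf(1)[OF \<sigma>] sub_gamma(4)[OF \<sigma>]]
    by (simp add: mult.assoc)
  have cone_or_K: "(\<forall>\<tau>>0. integrable M (\<lambda>\<omega>. (norm (closest_point C (\<tau> *\<^sub>R h \<omega>)))\<^sup>2)) \<and>
      ((\<lambda>\<tau>. (\<integral>\<omega>. (norm (closest_point C (\<tau> *\<^sub>R h \<omega>)))\<^sup>2 \<partial>M) / \<tau>\<^sup>2) \<longlongrightarrow> stat_dim M h C) at_top"
    if "C \<in> {K, tangent_cone K \<mu>0}" for C
  proof -
    have C: "closed C" "convex C" "C \<noteq> {}" using that K Kne T Tne by auto
    show ?thesis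
      using integrable_projection_error[OF law C, where a = 0]
        expected_projection_error_tendsto(2)[OF law C, of 0] stat_dim_eq[OF law C] by simp
  qed
  have ratio: "\<exists>L. ((\<lambda>\<tau>. (norm (closest_point K (\<tau> *\<^sub>R x)))\<^sup>2 / \<tau>\<^sup>2) \<longlongrightarrow> L) at_top \<and>
      (\<forall>\<sigma>>0. L \<le> err K \<mu>0 \<sigma> x / \<sigma>\<^sup>2 \<and> err K \<mu>0 \<sigma> x / \<sigma>\<^sup>2 \<le> (norm x)\<^sup>2) \<and>
      ((\<lambda>\<sigma>. err K \<mu>0 \<sigma> x / \<sigma>\<^sup>2) \<longlongrightarrow> L) at_top" for x
  proof (intro exI[of _ "(recession_ratio K x)\<^sup>2"] conjI allI impI)
    have err: "err K \<mu>0 \<sigma> x / \<sigma>\<^sup>2 = (norm (closest_point K (\<mu>0 + \<sigma> *\<^sub>R x) - \<mu>0) / \<sigma>)\<^sup>2" for \<sigma>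
      by (simp add: err_def power_divide)
    show "((\<lambda>\<tau>. (norm (closest_point K (\<tau> *\<^sub>R x)))\<^sup>2 / \<tau>\<^sup>2) \<longlongrightarrow> (recession_ratio K x)\<^sup>2) at_top"
      using tendsto_power[OF projection_ratio_tendsto[OF K Kne, of 0 x], of 2] by (simp add: power_divide)
    show "((\<lambda>\<sigma>. err K \<mu>0 \<sigma> x / \<sigma>\<^sup>2) \<longlongrightarrow> (recession_ratio K x)\<^sup>2) at_top"
      unfolding err by (intro tendsto_power projection_ratio_tendsto[OF K Kne])
    fix \<sigma> :: real assume \<sigma>: "0 < \<sigma>"
    show "(recession_ratio K x)\<^sup>2 \<le> err K \<mu>0 \<sigma> x / \<sigma>\<^sup>2"
      unfolding err
      by (intro power_mono recession_ratio_le[OF K Kne \<sigma>] recession_ratio_nonneg[OF K Kne])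
    have "norm (closest_point K (\<mu>0 + \<sigma> *\<^sub>R x) - \<mu>0) / \<sigma> \<le> norm x"
      using projection_ratio_le[OF K Kne \<sigma>, of \<mu>0 x] by (simp add: closest_point_self[OF \<mu>0])
    then show "err K \<mu>0 \<sigma> x / \<sigma>\<^sup>2 \<le> (norm x)\<^sup>2"
      unfolding err using \<sigma> by (intro power_mono) auto
  qed
  have at_infinity: "((\<lambda>\<sigma>. m \<sigma> / \<sigma>\<^sup>2) \<longlongrightarrow> stat_dim M h K) at_top"
    using expected_projection_error_tendsto(2)[OF law K Kne, of \<mu>0] stat_dim_eq[OF law K Kne]
    by (simp add: m_def err_def)
  have at_zero: "((\<lambda>\<sigma>. m \<sigma> / \<sigma>\<^sup>2) \<longlongrightarrow> stat_dim M h (tangent_cone K \<mu>0)) (at_right 0)"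
    using expected_projection_error_tendsto_tangent_cone[OF law K \<mu>0] by (simp add: m_def err_def)
  \<comment> \<open>The pointwise lower bound integrates to one valid at every noise level; sending
    \<sigma> to 0 then compares the two statistical dimensions.\<close>
  have "stat_dim M h K \<le> m \<sigma> / \<sigma>\<^sup>2" if \<sigma>: "\<sigma> > 0" for \<sigma>
  proof -
    have "stat_dim M h K = expectation (\<lambda>\<omega>. (recession_ratio K (h \<omega>))\<^sup>2)"
      by (rule stat_dim_eq[OF law K Kne])
    also have "\<dots> \<le> expectation (\<lambda>\<omega>. err K \<mu>0 \<sigma> (h \<omega>) / \<sigma>\<^sup>2)"
    proof (rule integral_mono)
      show "integrable M (\<lambda>\<omega>. (recession_ratio K (h \<omega>))\<^sup>2)"
        by (rule expected_projection_error_tendsto(1)[OF law K Kne])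
      show "integrable M (\<lambda>\<omega>. err K \<mu>0 \<sigma> (h \<omega>) / \<sigma>\<^sup>2)" using int[OF \<sigma>] by simp
      fix \<omega>
      have "(recession_ratio K (h \<omega>))\<^sup>2 \<le> (norm (closest_point K (\<mu>0 + \<sigma> *\<^sub>R h \<omega>) - \<mu>0) / \<sigma>)\<^sup>2"
        by (intro power_mono recession_ratio_le[OF K Kne \<sigma>] recession_ratio_nonneg[OF K Kne])
      then show "(recession_ratio K (h \<omega>))\<^sup>2 \<le> err K \<mu>0 \<sigma> (h \<omega>) / \<sigma>\<^sup>2"
        by (simp add: err_def power_divide)
    qed
    finally show ?thesis by (simp add: m_def)
  qed
  then have dim_le: "stat_dim M h K \<le> stat_dim M h (tangent_cone K \<mu>0)"
    by (intro tendsto_lowerbound[OF at_zero] eventually_at_right_less[THEN eventually_mono]) auto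
  note moments = at_infinity at_zero var(2) mgf tail
  show ?thesis
    by (intro conjI allI ballI impI)
       (assumption | rule int int2 cone_or_K[THEN conjunct1, rule_format]
         cone_or_K[THEN conjunct2] ratio dim_le moments[unfolded m_def])+
qed

end
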